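(* Let $h>0$, let $B\subset\mathbb Z^8_h$ be bounded and let $f:\partial B\to\mathbb O$. Then: (1) there exists $u:\overline B\to\mathbb O$ with $D^hu(y)=0$ for all $y\in B$ and $u|_{\partial B}=f$ if and only if $P^h_{\partial B}f(y)=f(y)$ for all $y\in\partial B$; (2) there exists $v:\overline{\mathbb Z^8_h\setminus B}\to\mathbb O$ with $D^hv(y)=0$ for all $y\in\mathbb Z^8_h\setminus B$, $|v(y)|\to0$ as $|y|\to\infty$, and $v|_{\partial B}=f$ if and only if $Q^h_{\partial B}f(y)=f(y)$ for all $y\in\partial B$.
   Context: $\mathbb O$ is the real octonion algebra with basis $\mathbf e_0=1,\mathbf e_1,\dots,\mathbf e_7$, where $\mathbf e_i\mathbf e_j=-\delta_{ij}+\sum_k\varepsilon_{ijk}\mathbf e_k$ for $1\le i,j\le 7$, $\varepsilon_{ijk}$ totally antisymmetric with $\varepsilon_{ijk}=1$ for $ijk\in\{123,145,176,246,257,347,365\}$; $\overline{\mathbf e}_0=\mathbf e_0$, $\overline{\mathbf e}_l=-\mathbf e_l$ ($l\ge1$); $|\cdot|$ is the Euclidean norm. For $h>0$, $\mathbb Z^8_h=(h\mathbb Z)^8$, $e_0,\dots,e_7$ are the standard unit vectors of $\mathbb R^8$, $\chi_A$ is the indicator of $A$. $\partial_l^{+,h}f(x)=(f(x+he_l)-f(x))/h$, $\partial_l^{-,h}f(x)=(f(x)-f(x-he_l))/h$, $\partial_l^h=\frac12(\partial_l^{+,h}+\partial_l^{-,h})$, $D^hf=\sum_l\mathbf e_l\partial_l^hf$.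 $N(x)=\{x,x\pm he_0,\dots,x\pm he_7\}$; for $A\subset\mathbb Z^8_h$: $\partial A=\{x:\ N(x)\cap A\neq\emptyset,\ N(x)\cap(\mathbb Z^8_h\setminus A)\neq\emptyset\}$, $\overline A=A\cup\partial A$ (note $\partial(\mathbb Z^8_h\setminus B)=\partial B$). For $x\in\partial B$: $\Sigma(x)=\sum_l[(\partial_l^{+,h}\chi_B(x))^2+(\partial_l^{-,h}\chi_B(x))^2]$, $s(x)=\frac{h^8}{2}\sqrt{\Sigma(x)}$, $n_l^\pm(x)=-2\partial_l^{\pm,h}\chi_B(x)/\sqrt{\Sigma(x)}$, $\int_{\partial B}g\,dS=\sum_{x\in\partial B}g(x)s(x)$. Fundamental solution: $E^1(x)=\frac{1}{(2\pi)^8}\int_{[-\pi,\pi]^8}\frac{\sum_l\overline{\mathbf e}_l\sin u_l}{\sum_l\sin^2u_l}\sin(\sum_lu_lx_l)\,du$ ($x\in\mathbb Z^8$), $E^h(x)=h^{-7}E^1(x/h)$. Star product: $K^h(x,y)*g(x)=-\frac12\sum_{l=0}^7\big(E^h(he_l-x+y)n_l^-(x)+E^h(-he_l-x+y)n_l^+(x)\big)(\mathbf e_lg(x))$. For $g:\partial B\to\mathbb O$: $S^h_{\partial B}g(y)=2\int_{\partial B}K^h(x,y)*\big(g(x)-g(y)\big)dS(x)+g(y)$ ($y\in\partial B$), $P^h_{\partial B}g=\frac12(g+S^h_{\partial B}g)$, $Q^h_{\partial B}g=\frac12(g-S^h_{\partial B}g)$. *)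

theory Defs
  imports "HOL-Analysis.Analysis"
begin

type_synonym oct = "real ^ 8"
type_synonym pt = "real ^ 8"

definition ix :: "nat \<Rightarrow> 8" where "ix l = of_nat l"

definition ebas :: "nat \<Rightarrow> real ^ 8" where "ebas l = axis (ix l) 1"

definition triples :: "(nat \<times> nat \<times> nat) list" where
  "triples = [(1,2,3),(1,4,5),(1,7,6),(2,4,6),(2,5,7),(3,4,7),(3,6,5)]"

definition cyc :: "(nat \<times> nat \<times> nat) set" where
  "cyc = (\<Union>(a,b,c)\<in>set triples. {(a,b,c),(b,c,a),(c,a,b)})"

definition eps :: "nat \<Rightarrow> nat \<Rightarrow> nat \<Rightarrow> real" where
  "eps i j k = (if (i,j,k) \<in> cyc then 1 else if (j,i,k) \<in> cyc then -1 else 0)"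

definition emul :: "nat \<Rightarrow> nat \<Rightarrow> oct" where
  "emul i j = (if i = 0 then ebas j else if j = 0 then ebas i
               else if i = j then - ebas 0
               else (\<Sum>k\<in>{1..7}. eps i j k *\<^sub>R ebas k))"

definition omul :: "oct \<Rightarrow> oct \<Rightarrow> oct" where
  "omul x y = (\<Sum>i<8. \<Sum>j<8. (x $ ix i * y $ ix j) *\<^sub>R emul i j)"

definition Zh :: "real \<Rightarrow> pt set" where
  "Zh h = {x. \<forall>i. \<exists>k::int. x $ i = h * of_int k}"

definition dplus :: "real \<Rightarrow> nat \<Rightarrow> (pt \<Rightarrow> 'a::real_vector) \<Rightarrow> pt \<Rightarrow> 'a" where
  "dplus h l f x = (1 / h) *\<^sub>R (f (x + h *\<^sub>R ebas l) - f x)"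

definition dminus :: "real \<Rightarrow> nat \<Rightarrow> (pt \<Rightarrow> 'a::real_vector) \<Rightarrow> pt \<Rightarrow> 'a" where
  "dminus h l f x = (1 / h) *\<^sub>R (f x - f (x - h *\<^sub>R ebas l))"

definition dcent :: "real \<Rightarrow> nat \<Rightarrow> (pt \<Rightarrow> 'a::real_vector) \<Rightarrow> pt \<Rightarrow> 'a" where
  "dcent h l f x = (1 / 2) *\<^sub>R (dplus h l f x + dminus h l f x)"

definition Dh :: "real \<Rightarrow> (pt \<Rightarrow> oct) \<Rightarrow> pt \<Rightarrow> oct" where
  "Dh h f x = (\<Sum>l<8. omul (ebas l) (dcent h l f x))"

definition nbhd :: "real \<Rightarrow> pt \<Rightarrow> pt set" where
  "nbhd h x = {x} \<union> {x + h *\<^sub>R ebas l | l. l < 8} \<union> {x - h *\<^sub>R ebas l | l. l < 8}"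

definition bdry :: "real \<Rightarrow> pt set \<Rightarrow> pt set" where
  "bdry h A = {x. nbhd h x \<inter> A \<noteq> {} \<and> nbhd h x \<inter> (Zh h - A) \<noteq> {}}"

definition clos :: "real \<Rightarrow> pt set \<Rightarrow> pt set" where
  "clos h A = A \<union> bdry h A"

definition Sig :: "real \<Rightarrow> pt set \<Rightarrow> pt \<Rightarrow> real" where
  "Sig h B x = (\<Sum>l<8. (dplus h l (indicator B) x)\<^sup>2 + (dminus h l (indicator B) x)\<^sup>2)"

definition sw :: "real \<Rightarrow> pt set \<Rightarrow> pt \<Rightarrow> real" where
  "sw h B x = h ^ 8 / 2 * sqrt (Sig h B x)"

definition nplus :: "real \<Rightarrow> pt set \<Rightarrow> nat \<Rightarrow> pt \<Rightarrow> real" where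
  "nplus h B l x = - 2 * dplus h l (indicator B) x / sqrt (Sig h B x)"

definition nminus :: "real \<Rightarrow> pt set \<Rightarrow> nat \<Rightarrow> pt \<Rightarrow> real" where
  "nminus h B l x = - 2 * dminus h l (indicator B) x / sqrt (Sig h B x)"

definition bint :: "real \<Rightarrow> pt set \<Rightarrow> (pt \<Rightarrow> oct) \<Rightarrow> oct" where
  "bint h B g = (\<Sum>x\<in>bdry h B. sw h B x *\<^sub>R g x)"

text \<open>Fundamental solution E^1 (meant for x in Z^8) and E^h.
  The integrand is sum_l conj(e_l) sin u_l / (sum_l sin^2 u_l) * sin(u.x).\<close>
definition E1 :: "pt \<Rightarrow> oct" where
  "E1 x = (1 / (2 * pi) ^ 8) *\<^sub>R
     integral (cbox (- (\<chi> i. pi)) (\<chi> i. pi))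
       (\<lambda>u::real^8. (sin (u \<bullet> x) / (\<Sum>i\<in>UNIV. (sin (u $ i))\<^sup>2)) *\<^sub>R
          (\<chi> j. (if j = ix 0 then 1 else -1) * sin (u $ j)))"

definition Eh :: "real \<Rightarrow> pt \<Rightarrow> oct" where
  "Eh h x = (1 / h ^ 7) *\<^sub>R E1 ((1 / h) *\<^sub>R x)"

definition Kstar :: "real \<Rightarrow> pt set \<Rightarrow> pt \<Rightarrow> pt \<Rightarrow> oct \<Rightarrow> oct" where
  "Kstar h B x y g = (- (1 / 2)) *\<^sub>R (\<Sum>l<8.
      omul (nminus h B l x *\<^sub>R Eh h (h *\<^sub>R ebas l - x + y)
            + nplus h B l x *\<^sub>R Eh h (- (h *\<^sub>R ebas l) - x + y))
           (omul (ebas l) g))"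

definition Sop :: "real \<Rightarrow> pt set \<Rightarrow> (pt \<Rightarrow> oct) \<Rightarrow> pt \<Rightarrow> oct" where
  "Sop h B g y = 2 *\<^sub>R bint h B (\<lambda>x. Kstar h B x y (g x - g y)) + g y"

definition Pop :: "real \<Rightarrow> pt set \<Rightarrow> (pt \<Rightarrow> oct) \<Rightarrow> pt \<Rightarrow> oct" where
  "Pop h B g y = (1 / 2) *\<^sub>R (g y + Sop h B g y)"

definition Qop :: "real \<Rightarrow> pt set \<Rightarrow> (pt \<Rightarrow> oct) \<Rightarrow> pt \<Rightarrow> oct" where
  "Qop h B g y = (1 / 2) *\<^sub>R (g y - Sop h B g y)"

end

(* The components F_k of the fundamental solution are Fourier coefficients of sin u_k / sum sin^2 u_l,
   so their central differences d_l F_k are symmetric in k and l, with divergence the delta function.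
   Alternativity of the octonions, polarised as conj(e_k)(e_l a) + conj(e_l)(e_k a) = 2 delta_kl a
   (and with the outer factors swapped), then replaces associativity: it makes a |-> E(. - z) a a
   fundamental solution of D^h and gives the discrete Cauchy-Pompeiu formula
     int_{bdry B} K(x,y) * g dS = chi_B(y) g(y) - (V g)(y),  V g (y) = h^8 sum_{z in B} E(y - z) (D^h g)(z).
   Applied to g - g(y) this reads P f = f - V f and Q f = V f on the boundary, where D^h (V f) = chi_B D^h f
   and V f decays (Bessel's inequality on the cube). So u = f - V f and v = V f are the required
   extensions. Conversely V f depends only on the boundary values of f: V u = 0 for an interior extension u,
   and V v = v for a decaying exterior extension v by the maximum principle, since v - V v is harmonic
   with respect to steps of length 2h. *)
theory Submission
  imports Defs
begin

section \<open>Octonion multiplication\<close>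

text \<open>The type \<open>8\<close> consists of the integers modulo 8, so the sums over
  \<open>l < 8\<close> in the definitions and sums over the coordinates of a vector have the same
  index set. The lemmas here convert between the two.\<close>

lemma range_ix: "ix ` {..<8} = UNIV"
proof -
  have "\<exists>l<8. x = ix l" for x :: 8
  proof (cases x rule: bit0_cases)
    case (of_int z)
    then have "x = ix (nat z)" "nat z < 8"
      by (simp_all add: ix_def)
    then show ?thesis by blast
  qed
  then show ?thesis by auto
qed

lemma inj_on_ix: "inj_on ix {..<8}"
  by (rule eq_card_imp_inj_on) (simp_all add: range_ix)

lemma bij_betw_ix: "bij_betw ix {..<8} UNIV"
  by (simp add: bij_betw_def inj_on_ix range_ix)

lemma ix_eq_iff: "k < 8 \<Longrightarrow> l < 8 \<Longrightarrow> ix k = ix l \<longleftrightarrow> k = l"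
  using inj_on_ix by (auto simp: inj_on_def)

lemma forall_ix: "(\<forall>i. P i) \<longleftrightarrow> (\<forall>k<8. P (ix k))"
  by (metis UNIV_I imageE lessThan_iff range_ix)

lemma sum_UNIV_ix: "sum g UNIV = (\<Sum>k<8. g (ix k))"
  by (simp add: sum.reindex_bij_betw[OF bij_betw_ix])

lemma ebas_nth: "k < 8 \<Longrightarrow> l < 8 \<Longrightarrow> ebas k $ ix l = (if k = l then 1 else 0)"
  by (simp add: ebas_def axis_def ix_eq_iff)

lemma oct_expand: "x = (\<Sum>k<8. (x $ ix k) *\<^sub>R ebas k)"
  unfolding vec_eq_iff forall_ix by (simp add: ebas_nth if_distrib sum.delta cong: if_cong)

text \<open>Finite dimension turns bilinearity into boundedness. The interpretation below then
  supplies the distributivity rules and the norm bound needed for the decay of the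
  potential.\<close>

lemma bounded_bilinear_omul: "bounded_bilinear omul"
  unfolding bilinear_conv_bounded_bilinear[symmetric] bilinear_def omul_def
  by (auto intro!: linearI simp: algebra_simps sum.distrib scaleR_right.sum)

interpretation omul: bounded_bilinear omul
  by (rule bounded_bilinear_omul)

lemma all_less_8: "(\<forall>k<8. P k) \<longleftrightarrow>
    P 0 \<and> P 1 \<and> P 2 \<and> P 3 \<and> P 4 \<and> P 5 \<and> P 6 \<and> P (7::nat)"
  by (simp add: numeral_eq_Suc All_less_Suc2 del: One_nat_def) (simp add: numeral_eq_Suc)

lemma sum_less_8: "(\<Sum>k<8. g k) = g 0 + g 1 + g 2 + g 3 + g 4 + g 5 + g 6 + g (7::nat)"
  by (simp add: eval_nat_numeral lessThan_Suc add_ac)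

lemma emul_nth:
  assumes "i < 8" "j < 8" "k < 8"
  shows "emul i j $ ix k = (if i = 0 then (if j = k then 1 else 0)
      else if j = 0 then (if i = k then 1 else 0)
      else if i = j then (if k = 0 then -1 else 0)
      else if k = 0 then 0 else eps i j k)"
proof -
  have "(\<Sum>m\<in>{1..7}. eps i j m *\<^sub>R ebas m) $ ix k = (\<Sum>m\<in>{1..7}. if m = k then eps i j k else 0)"
    unfolding sum_component using assms by (intro sum.cong) (auto simp: ebas_nth)
  also have "\<dots> = (if k = 0 then 0 else eps i j k)"
    using assms by simp
  finally show ?thesis using assms by (auto simp: emul_def ebas_nth)
qed

lemma omul_ebas_nth:
  assumes "l < 8" "k < 8"
  shows "omul (ebas l) a $ ix k = (\<Sum>j<8. a $ ix j * emul l j $ ix k)"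
proof -
  have "omul (ebas l) a $ ix k = (\<Sum>i<8. if i = l then (\<Sum>j<8. a $ ix j * emul i j $ ix k) else 0)"
    unfolding omul_def sum_component
    by (rule sum.cong[OF refl]) (use assms in \<open>auto simp: ebas_nth\<close>)
  then show ?thesis using assms by simp
qed

lemma omul_ebas_table:
  "\<forall>l<8. \<forall>k<8. omul (ebas l) a $ ix k = a $ ix 0 * emul l 0 $ ix k + a $ ix 1 * emul l 1 $ ix k
     + a $ ix 2 * emul l 2 $ ix k + a $ ix 3 * emul l 3 $ ix k + a $ ix 4 * emul l 4 $ ix k
     + a $ ix 5 * emul l 5 $ ix k + a $ ix 6 * emul l 6 $ ix k + a $ ix 7 * emul l 7 $ ix k"
  by (simp add: omul_ebas_nth sum_less_8 del: One_nat_def)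

text \<open>Left multiplication by each basis unit, fully evaluated in coordinates, which reduces
  the polar identities below to a finite check.\<close>

lemmas omul_ebas_values = omul_ebas_table[unfolded all_less_8, simplified emul_nth eps_def cyc_def triples_def, simplified]

text \<open>The sign in \<open>conj (e k) = csgn k * e k\<close>.\<close>
definition csgn :: "nat \<Rightarrow> real" where "csgn k = (if k = 0 then 1 else -1)"

text \<open>Polarised left alternativity, verified coordinatewise for all 64 index pairs. It allows
  products conj(e_k) (e_l a) to be summed against coefficients symmetric in \<open>k\<close> and
  \<open>l\<close> without associativity.\<close>

lemma omul_conj_polar:
  assumes "k < 8" "l < 8"
  shows "csgn k *\<^sub>R omul (ebas k) (omul (ebas l) a) + csgn l *\<^sub>R omul (ebas l) (omul (ebas k) a)
           = (if k = l then 2 *\<^sub>R a else 0)"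
proof -
  have "\<forall>k<8. \<forall>l<8. csgn k *\<^sub>R omul (ebas k) (omul (ebas l) a) + csgn l *\<^sub>R omul (ebas l) (omul (ebas k) a)
           = (if k = l then 2 *\<^sub>R a else 0)"
    unfolding vec_eq_iff forall_ix unfolding all_less_8
    by (simp add: csgn_def omul_ebas_values)
  then show ?thesis using assms by blast
qed

text \<open>The companion with the conjugate on the inner factor, for the case where D^h acts from
  the left on a product of the kernel with a constant.\<close>

lemma omul_conj_polar':
  assumes "k < 8" "l < 8"
  shows "csgn k *\<^sub>R omul (ebas l) (omul (ebas k) a) + csgn l *\<^sub>R omul (ebas k) (omul (ebas l) a)
           = (if k = l then 2 *\<^sub>R a else 0)"
proof -
  have "\<forall>k<8. \<forall>l<8. csgn k *\<^sub>R omul (ebas l) (omul (ebas k) a) + csgn l *\<^sub>R omul (ebas k) (omul (ebas l) a)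
           = (if k = l then 2 *\<^sub>R a else 0)"
    unfolding vec_eq_iff forall_ix unfolding all_less_8
    by (simp add: csgn_def omul_ebas_values)
  then show ?thesis using assms by blast
qed

section \<open>Integrability of the inverse symbol\<close>

text \<open>With s = t/2, the inequality s cos s <= sin s gives sin t = 2 sin s cos s >= t (cos s)^2
  = t (1 + cos t) / 2, and cos t >= 0 on this range.\<close>

lemma half_le_sin:
  fixes t :: real
  assumes "0 \<le> t" "t \<le> pi / 2"
  shows "t / 2 \<le> sin t"
proof -
  define s where "s = t / 2"
  have s: "0 \<le> s" "s \<le> pi / 4" using assms by (auto simp: s_def)
  have "sin 0 - 0 * cos 0 \<le> sin s - s * cos s"
  proof (rule DERIV_nonneg_imp_nondecreasing[OF s(1)])
    fix x assume "0 \<le> x" "x \<le> s"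
    moreover have "((\<lambda>x. sin x - x * cos x) has_real_derivative x * sin x) (at x)"
      by (auto intro!: derivative_eq_intros)
    moreover have "0 \<le> sin x" using calculation s by (intro sin_ge_zero) auto
    ultimately show "\<exists>y. ((\<lambda>x. sin x - x * cos x) has_real_derivative y) (at x) \<and> 0 \<le> y"
      by (intro exI[of _ "x * sin x"]) auto
  qed
  then have "s * cos s \<le> sin s" by simp
  moreover have "0 \<le> cos s" using s by (intro cos_ge_zero) auto
  ultimately have "s * cos s * cos s \<le> sin s * cos s" by (rule mult_right_mono)
  moreover have "sin t = 2 * sin s * cos s" using sin_double[of s] by (simp add: s_def)
  moreover have "cos t = 2 * (cos s)\<^sup>2 - 1" using cos_double_cos[of s] by (simp add: s_def)
  moreover have "0 \<le> cos t" using assms by (intro cos_ge_zero) auto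
  then have "0 \<le> t * cos t" using assms by simp
  ultimately have "t * (1 + cos t) \<le> 2 * sin t" "0 \<le> t * cos t"
    by (simp_all add: s_def power2_eq_square mult_ac)
  then show ?thesis
    by (simp add: algebra_simps)
qed

lemma abs_sin_ge_dist:
  fixes t :: real
  assumes "t \<in> {-pi..pi}"
  obtains c where "c \<in> {0, pi, -pi}" "\<bar>t - c\<bar> / 2 \<le> \<bar>sin t\<bar>"
proof -
  consider "0 \<le> t" "t \<le> pi / 2" | "pi / 2 \<le> t" | "t \<le> 0" "- (pi / 2) \<le> t" | "t \<le> - (pi / 2)"
    using assms by (auto simp: not_le) linarith
  then show ?thesis
  proof cases
    case 1 then show ?thesis using half_le_sin[of t] by (intro that[of 0]) auto
  next
    case 2 then show ?thesis using half_le_sin[of "pi - t"] assms by (intro that[of pi]) (auto simp: abs_if)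
  next
    case 3 then show ?thesis using half_le_sin[of "- t"] by (intro that[of 0]) auto
  next
    case 4 then show ?thesis using half_le_sin[of "pi + t"] assms by (intro that[of "- pi"]) (auto simp: abs_if)
  qed
qed

text \<open>The exponent exceeds -1, so the singularity at \<open>c\<close> is integrable. The value
  -1/4 comes from distributing 1 / \<open>symb u\<close> evenly over eight coordinates.\<close>

lemma nn_integral_abs_powr:
  "(\<integral>\<^sup>+t. ennreal (\<bar>t - c\<bar> powr (-1/4)) * indicator {a..b} t \<partial>lborel) < \<infinity>"
proof (cases "a \<le> b")
  case True
  \<comment> \<open>The sign factor makes \<open>G\<close> an antiderivative on both sides of
    \<open>c\<close> and continuous across it, so the fundamental theorem applies with
    \<open>c\<close> as an exceptional point.\<close>
  define G where "G t = 4/3 * sgn (t - c) * \<bar>t - c\<bar> powr (3/4)" for t :: real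
  have "((\<lambda>t. \<bar>t - c\<bar> powr (-1/4)) has_integral (G b - G a)) {a..b}"
  proof (rule fundamental_theorem_of_calculus_interior_strong[of "{c}", OF _ True])
    fix t assume t: "t \<in> {a<..<b} - {c}"
    show "(G has_vector_derivative \<bar>t - c\<bar> powr (-1/4)) (at t)"
    proof (cases "t > c")
      case True
      have "((\<lambda>t. 4/3 * (t - c) powr (3/4)) has_real_derivative \<bar>t - c\<bar> powr (-1/4)) (at t)"
        using True by (auto intro!: derivative_eq_intros)
      then have "(G has_real_derivative \<bar>t - c\<bar> powr (-1/4)) (at t)"
        by (rule DERIV_cong_ev[THEN iffD1, rotated -1])
           (use True in \<open>auto simp: G_def intro!: eventually_mono[OF eventually_gt_at_top] eventually_nhds_in_open[of "{c<..}", THEN eventually_mono]\<close>)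
      then show ?thesis by (simp add: has_real_derivative_iff_has_vector_derivative)
    next
      case False
      have "((\<lambda>t. - (4/3 * (c - t) powr (3/4))) has_real_derivative \<bar>t - c\<bar> powr (-1/4)) (at t)"
        using False t by (auto intro!: derivative_eq_intros)
      then have "(G has_real_derivative \<bar>t - c\<bar> powr (-1/4)) (at t)"
        by (rule DERIV_cong_ev[THEN iffD1, rotated -1])
           (use False t in \<open>auto simp: G_def intro!: eventually_nhds_in_open[of "{..<c}", THEN eventually_mono]\<close>)
      then show ?thesis by (simp add: has_real_derivative_iff_has_vector_derivative)
    qed
  next
    have "G = (\<lambda>t. 4/3 * (max 0 (t - c) powr (3/4) - max 0 (c - t) powr (3/4)))"
      by (rule ext) (auto simp: G_def max_def sgn_if abs_if)
    then show "continuous_on {a..b} G"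
      by (simp only:, intro continuous_intros continuous_on_powr') (auto simp: max_def)
  qed simp
  then have "(\<integral>\<^sup>+t. ennreal (\<bar>t - c\<bar> powr (-1/4)) * indicator {a..b} t \<partial>lborel) = ennreal (G b - G a)"
    by (intro nn_integral_has_integral_lebesgue') auto
  then show ?thesis by simp
qed simp

lemma nn_integral_abs_sin_powr:
  "(\<integral>\<^sup>+t. ennreal (\<bar>sin t\<bar> powr (-1/4)) * indicator {-pi..pi} t \<partial>lborel) < \<infinity>"
proof -
  define p where "p c t = ennreal (\<bar>t - c\<bar> powr (-1/4)) * indicator {-pi..pi} t" for c t :: real
  have p_meas [measurable]: "p c \<in> borel_measurable borel" for c
    unfolding p_def by measurable
  have p_fin: "(\<integral>\<^sup>+t. p c t \<partial>lborel) < \<infinity>" for c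
    unfolding p_def by (rule nn_integral_abs_powr)
  \<comment> \<open>The three centres are the zeros of sine in the interval, and the constant 2
    absorbs \<open>2 powr (1/4)\<close>. At the zeros themselves the left side is 0, because
    \<open>0 powr (-1/4) = 0\<close>.\<close>
  have "ennreal (\<bar>sin t\<bar> powr (-1/4)) * indicator {-pi..pi} t \<le> 2 * (p 0 t + p pi t + p (-pi) t)" for t
  proof (cases "t \<in> {-pi..pi} \<and> sin t \<noteq> 0")
    case True
    then obtain c where c: "c \<in> {0, pi, -pi}" "\<bar>t - c\<bar> / 2 \<le> \<bar>sin t\<bar>"
      using abs_sin_ge_dist by blast
    have "t \<noteq> c" using True c(1) by auto
    then have "\<bar>sin t\<bar> powr (-1/4) \<le> (\<bar>t - c\<bar> / 2) powr (-1/4)"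
      using c(2) by (intro powr_mono2') auto
    also have "\<dots> = 2 powr (1/4) * \<bar>t - c\<bar> powr (-1/4)"
      by (simp add: powr_divide powr_minus field_simps)
    also have "\<dots> \<le> 2 * \<bar>t - c\<bar> powr (-1/4)"
      using powr_mono[of "1/4" 1 "2::real"] by (intro mult_right_mono) auto
    finally have "ennreal (\<bar>sin t\<bar> powr (-1/4)) \<le> 2 * ennreal (\<bar>t - c\<bar> powr (-1/4))"
      by (metis ennreal_leI ennreal_mult'' ennreal_numeral powr_ge_zero)
    then have "ennreal (\<bar>sin t\<bar> powr (-1/4)) * indicator {-pi..pi} t \<le> 2 * p c t"
      using True by (simp add: p_def)
    also have "\<dots> \<le> 2 * (p 0 t + p pi t + p (-pi) t)"
      using c(1) by (intro mult_left_mono) (auto simp: add_increasing add_increasing2)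
    finally show ?thesis .
  qed (auto simp: indicator_def)
  then have "(\<integral>\<^sup>+t. ennreal (\<bar>sin t\<bar> powr (-1/4)) * indicator {-pi..pi} t \<partial>lborel)
      \<le> (\<integral>\<^sup>+t. 2 * (p 0 t + p pi t + p (-pi) t) \<partial>lborel)"
    by (intro nn_integral_mono)
  also have "\<dots> = 2 * ((\<integral>\<^sup>+t. p 0 t \<partial>lborel) + (\<integral>\<^sup>+t. p pi t \<partial>lborel) + (\<integral>\<^sup>+t. p (-pi) t \<partial>lborel))"
    by (simp add: nn_integral_cmult nn_integral_add)
  also have "\<dots> < \<infinity>"
    by (simp add: ennreal_mult_less_top p_fin[simplified])
  finally show ?thesis .
qed

abbreviation cube :: "(real^8) set" where "cube \<equiv> cbox (- (\<chi> i. pi)) (\<chi> i. pi)"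

abbreviation cube_measure :: "(real^8) measure" where
  "cube_measure \<equiv> restrict_space lborel cube"

text \<open>The Fourier symbol of minus the sum of the squared central differences with unit step.
  On the cube it vanishes exactly where every coordinate is -pi, 0 or pi.\<close>

definition symb :: "real^8 \<Rightarrow> real" where "symb u = (\<Sum>i\<in>UNIV. (sin (u $ i))\<^sup>2)"

lemma Basis_eq_axis: "(Basis :: (real^'n) set) = range (\<lambda>i. axis i 1)"
  by (auto simp: Basis_vec_def)

lemma inj_axis: "inj (\<lambda>i::'n::finite. axis i (1::real))"
  by (auto simp: inj_on_def axis_eq_axis)

lemma prod_Basis_inner: "(\<Prod>b\<in>Basis. g ((u::real^'n) \<bullet> b)) = (\<Prod>i\<in>UNIV. g (u $ i))"
  by (simp add: Basis_eq_axis prod.reindex[OF inj_axis] inner_axis)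

lemma AE_sin_nonzero: "AE u in (lborel :: (real^'n) measure). \<forall>i. sin (u $ i) \<noteq> 0"
proof -
  have "AE u in (lborel :: (real^'n) measure). u $ i \<noteq> of_int n * pi" for i n
  proof -
    have "negligible {u :: real^'n. u \<bullet> axis i 1 = of_int n * pi}"
      by (rule negligible_standard_hyperplane) (simp add: Basis_eq_axis)
    moreover have "{u :: real^'n. u \<bullet> axis i 1 = of_int n * pi} \<in> sets borel"
      by measurable
    ultimately have "{u :: real^'n. u \<bullet> axis i 1 = of_int n * pi} \<in> null_sets lborel"
      by (simp add: negligible_iff_null_sets null_sets_completion_iff)
    from AE_not_in[OF this] show ?thesis
      by (simp add: inner_axis)
  qed
  then have "AE u in (lborel :: (real^'n) measure). \<forall>i. \<forall>n. u $ i \<noteq> of_int n * pi"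
    by (simp add: AE_all_countable)
  then show ?thesis
    by eventually_elim (auto simp: sin_zero_iff_int2)
qed

lemma inverse_symb_le:
  assumes "\<And>i. sin (u $ i) \<noteq> 0"
  shows "1 / symb u \<le> (\<Prod>i\<in>UNIV. \<bar>sin (u $ i)\<bar> powr (-1/4))"
proof -
  have pos: "0 < symb u"
    unfolding symb_def using assms by (intro sum_pos) auto
  \<comment> \<open>The exponents add up: eight factors of \<open>(symb u) powr (-1/8)\<close> give \<open>1 / symb u\<close>.\<close>
  have "\<bar>sin (u $ i)\<bar> \<le> sqrt (symb u)" for i
    unfolding symb_def using member_le_sum[of i UNIV "\<lambda>i. (sin (u $ i))\<^sup>2"]
    by (intro real_le_rsqrt) simp
  then have "(\<Prod>i\<in>(UNIV :: 8 set). (sqrt (symb u)) powr (-1/4)) \<le> (\<Prod>i\<in>UNIV. \<bar>sin (u $ i)\<bar> powr (-1/4))"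
    using assms by (intro prod_mono) (auto intro!: powr_mono2')
  also have "(\<Prod>i\<in>(UNIV :: 8 set). (sqrt (symb u)) powr (-1/4)) = symb u powr (-1)"
    using pos by (simp add: powr_half_sqrt[symmetric] powr_powr powr_power)
  finally show ?thesis
    using pos by (simp add: powr_minus field_simps)
qed

lemma symb_measurable [measurable]: "symb \<in> borel_measurable borel"
  unfolding symb_def by measurable

text \<open>The product majorant separates the variables, so Tonelli bounds the integral by the
  eighth power of a finite one-dimensional integral. The majorant is only claimed almost everywhere,
  since \<open>powr\<close> gives 0 at zeros of the sines.\<close>

lemma integrable_inverse_symb: "integrable cube_measure (\<lambda>u. 1 / symb u)"
proof (rule integrableI_nonneg)
  show "(\<lambda>u. 1 / symb u) \<in> borel_measurable cube_measure"
    by (rule measurable_restrict_space1) measurable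
  show "AE u in cube_measure. 0 \<le> 1 / symb u"
    by (simp add: symb_def sum_nonneg)
  define q where "q t = ennreal (\<bar>sin t\<bar> powr (-1/4)) * indicator {-pi..pi} t" for t :: real
  have [measurable]: "q \<in> borel_measurable borel"
    unfolding q_def by measurable
  have q_fin: "(\<integral>\<^sup>+t. q t \<partial>lborel) < \<infinity>"
    unfolding q_def by (rule nn_integral_abs_sin_powr)
  have "(\<integral>\<^sup>+ u. ennreal (1 / symb u) \<partial>cube_measure)
      = (\<integral>\<^sup>+ u. ennreal (1 / symb u) * indicator cube u \<partial>lborel)"
    by (subst nn_integral_restrict_space) auto
  also have "\<dots> \<le> (\<integral>\<^sup>+ u. (\<Prod>b\<in>Basis. q (u \<bullet> b)) \<partial>(lborel :: (real^8) measure))"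
  proof (rule nn_integral_mono_AE)
    show "AE u in lborel. ennreal (1 / symb u) * indicator cube u \<le> (\<Prod>b\<in>Basis. q (u \<bullet> b))"
      using AE_sin_nonzero
    proof eventually_elim
      case (elim u)
      show ?case
      proof (cases "u \<in> cube")
        case True
        have "(\<Prod>b\<in>Basis. q (u \<bullet> b)) = (\<Prod>i\<in>UNIV. q (u $ i))"
          by (rule prod_Basis_inner)
        also have "\<dots> = (\<Prod>i\<in>UNIV. ennreal (\<bar>sin (u $ i)\<bar> powr (-1/4)))"
          using True by (simp add: q_def mem_box_cart)
        finally have "(\<Prod>b\<in>Basis. q (u \<bullet> b)) = (\<Prod>i\<in>UNIV. ennreal (\<bar>sin (u $ i)\<bar> powr (-1/4)))" .
        then show ?thesis
          using inverse_symb_le[of u] elim True by (simp add: prod_ennreal ennreal_leI)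
      qed simp
    qed
  qed
  also have "\<dots> = (\<Prod>b\<in>(Basis::(real^8) set). \<integral>\<^sup>+t. q t \<partial>lborel)"
    by (rule nn_integral_lborel_prod) auto
  also have "\<dots> < \<infinity>"
    using q_fin by (simp add: power_less_top_ennreal)
  finally show "(\<integral>\<^sup>+ u. ennreal (1 / symb u) \<partial>cube_measure) < \<infinity>" .
qed

section \<open>Fourier coefficients on the cube\<close>

text \<open>Lebesgue measure is the image of a product of one-dimensional Lebesgue measures under
  the coordinate map, so Fubini splits an integrand in product form.\<close>

lemma integral_lborel_prod:
  fixes f :: "'a::euclidean_space \<Rightarrow> real \<Rightarrow> complex"
  assumes "\<And>b. b \<in> Basis \<Longrightarrow> integrable lborel (f b)"
  shows "(LINT x|lborel. (\<Prod>b\<in>Basis. f b (x \<bullet> b))) = (\<Prod>b\<in>Basis. LINT t|lborel. f b t)"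
proof -
  have meas [measurable]: "f b \<in> borel_measurable borel" if "b \<in> Basis" for b
    using borel_measurable_integrable[OF assms[OF that]] by simp
  interpret product_sigma_finite "\<lambda>b::'a. lborel :: real measure"
    by unfold_locales
  have "(LINT x|lborel. (\<Prod>b\<in>Basis. f b (x \<bullet> b)))
      = (LINT g|(\<Pi>\<^sub>M b\<in>(Basis::'a set). lborel). (\<Prod>b\<in>Basis. f b ((\<Sum>c\<in>Basis. g c *\<^sub>R c) \<bullet> b)))"
    unfolding lborel_eq[where 'a='a] by (subst integral_distr) measurable
  also have "\<dots> = (LINT g|(\<Pi>\<^sub>M b\<in>(Basis::'a set). lborel). (\<Prod>b\<in>Basis. f b (g b)))"
    by simp
  also have "\<dots> = (\<Prod>b\<in>Basis. LINT t|lborel. f b t)"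
    by (rule product_integral_prod) (auto simp: assms)
  finally show ?thesis .
qed

lemma integral_cis_int:
  fixes n :: real
  assumes "n \<in> \<int>"
  shows "(LINT t|lborel. indicator {-pi..pi} t *\<^sub>R cis (t * n)) = (if n = 0 then 2 * pi else 0)"
proof -
  have "((\<lambda>t. cis (t * n)) has_integral (if n = 0 then 2 * pi else 0)) {-pi..pi}"
  proof (cases "n = 0")
    case True
    then show ?thesis
      using has_integral_const_real[of "1::complex" "-pi" pi] by (simp add: scaleR_conv_of_real)
  next
    case False
    have "((\<lambda>t. exp (\<i> * of_real n * of_real t) / (\<i> * of_real n)) has_vector_derivative cis (t * n)) (at t within {-pi..pi})" for t
      using False by (intro has_vector_derivative_real_field)
        (auto intro!: derivative_eq_intros simp: cis_conv_exp mult_ac)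
    then have "((\<lambda>t. cis (t * n)) has_integral
        (exp (\<i> * of_real n * of_real pi) / (\<i> * of_real n) - exp (\<i> * of_real n * of_real (-pi)) / (\<i> * of_real n))) {-pi..pi}"
      by (intro fundamental_theorem_of_calculus) auto
    moreover have "exp (\<i> * of_real n * of_real pi) = exp (\<i> * of_real n * of_real (-pi))"
    proof -
      obtain m :: int where "n = of_int m" using assms by (auto elim: Ints_cases)
      then show ?thesis by (intro complex_eqI) (simp_all add: Re_exp Im_exp sin_integer_2pi algebra_simps)
    qed
    ultimately show ?thesis using False by simp
  qed
  then have "integral {-pi..pi} (\<lambda>t. cis (t * n)) = (if n = 0 then 2 * pi else 0)"
    by blast
  moreover have "set_integrable lborel {-pi..pi} (\<lambda>t. cis (t * n))"
    by (intro borel_integrable_atLeastAtMost') (auto intro!: continuous_intros)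
  ultimately show ?thesis
    using set_borel_integral_eq_integral(2)[of "{-pi..pi}" "\<lambda>t. cis (t * n)"]
    by (simp add: set_lebesgue_integral_def)
qed

definition int_lattice :: "(real^8) set" where "int_lattice = {x. \<forall>i. x $ i \<in> \<int>}"

lemma finite_measure_cube: "finite_measure cube_measure"
  by (rule finite_measureI) (simp add: space_restrict_space emeasure_restrict_space emeasure_lborel_cbox_eq)

interpretation cube: finite_measure cube_measure
  by (rule finite_measure_cube)

lemma cube_measurable: "f \<in> borel_measurable borel \<Longrightarrow> f \<in> borel_measurable cube_measure"
  by (rule measurable_restrict_space1) simp

text \<open>The exponential factorises over the coordinates, and a single nonzero integer frequency
  already makes its factor integrate to zero.\<close>

lemma integral_cis_cube:
  assumes "x \<in> int_lattice"
  shows "(LINT u|cube_measure. cis (u \<bullet> x)) = (if x = 0 then (2 * pi) ^ 8 else 0)"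
proof -
  have int: "integrable lborel (\<lambda>t. indicator {-pi..pi} t *\<^sub>R cis (t * n))" for n
    using borel_integrable_atLeastAtMost'[of "-pi" pi "\<lambda>t. cis (t * n)"]
    by (simp add: set_integrable_def continuous_intros)
  have "(LINT u|cube_measure. cis (u \<bullet> x)) = (LINT u|lborel. indicator cube u *\<^sub>R cis (u \<bullet> x))"
    by (subst integral_restrict_space) auto
  also have "\<dots> = (LINT u|lborel. (\<Prod>b\<in>Basis. indicator {-pi..pi} (u \<bullet> b) *\<^sub>R cis ((u \<bullet> b) * (x \<bullet> b))))"
  proof (rule Bochner_Integration.integral_cong[OF refl])
    fix u :: "real^8"
    have "indicator cube u = (\<Prod>b\<in>Basis. indicator {-pi..pi} (u \<bullet> b) :: real)"
      unfolding prod_Basis_inner by (auto simp: indicator_def mem_box_cart)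
    moreover have "cis (u \<bullet> x) = (\<Prod>b\<in>Basis. cis ((u \<bullet> b) * (x \<bullet> b)))"
      by (subst euclidean_inner) (simp add: cis_conv_exp exp_sum sum_distrib_left)
    ultimately show "indicator cube u *\<^sub>R cis (u \<bullet> x)
        = (\<Prod>b\<in>Basis. indicator {-pi..pi} (u \<bullet> b) *\<^sub>R cis ((u \<bullet> b) * (x \<bullet> b)))"
      by (simp add: scaleR_conv_of_real prod.distrib)
  qed
  also have "\<dots> = (\<Prod>b\<in>Basis. LINT t|lborel. indicator {-pi..pi} t *\<^sub>R cis (t * (x \<bullet> b)))"
    by (rule integral_lborel_prod) (rule int)
  also have "\<dots> = (\<Prod>b\<in>Basis. if x \<bullet> b = 0 then 2 * pi else 0)"
  proof (subst of_real_prod, rule prod.cong[OF refl])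
    fix b :: "real^8" assume "b \<in> Basis"
    then have "x \<bullet> b \<in> \<int>" using assms by (auto simp: Basis_eq_axis inner_axis int_lattice_def)
    then show "(LINT t|lborel. indicator {-pi..pi} t *\<^sub>R cis (t * (x \<bullet> b))) = of_real (if x \<bullet> b = 0 then 2 * pi else 0)"
      by (simp add: integral_cis_int)
  qed
  also have "(\<Prod>b\<in>Basis. if x \<bullet> b = 0 then 2 * pi else 0) = (if x = 0 then (2 * pi) ^ 8 else 0)"
    by (auto simp: prod_zero_iff euclidean_eq_iff[of x 0])
  finally show ?thesis by simp
qed

lemma integrable_cube_bounded:
  fixes f :: "real^8 \<Rightarrow> 'b::{banach, second_countable_topology}"
  assumes "f \<in> borel_measurable borel" "\<And>u. norm (f u) \<le> C"
  shows "integrable cube_measure f"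
  using assms by (intro cube.integrable_const_bound[of _ C] cube_measurable) auto

lemma integral_cos_cube:
  assumes "x \<in> int_lattice"
  shows "(LINT u|cube_measure. cos (u \<bullet> x)) = (if x = 0 then (2 * pi) ^ 8 else 0)"
proof -
  have "integrable cube_measure (\<lambda>u. cis (u \<bullet> x))"
    by (rule integrable_cube_bounded[of _ 1]) (auto simp: cis_conv_exp)
  from integral_Re[OF this] show ?thesis
    using integral_cis_cube[OF assms] by (auto split: if_splits)
qed

lemma integral_sin_cube:
  assumes "x \<in> int_lattice"
  shows "(LINT u|cube_measure. sin (u \<bullet> x)) = 0"
proof -
  have "integrable cube_measure (\<lambda>u. cis (u \<bullet> x))"
    by (rule integrable_cube_bounded[of _ 1]) (auto simp: cis_conv_exp)
  from integral_Im[OF this] show ?thesis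
    using integral_cis_cube[OF assms] by (auto split: if_splits simp flip: of_real_power)
qed

text \<open>Hartley's kernel: a real family that, unlike the sines or the cosines alone, is orthogonal over
  the whole integer lattice.\<close>
definition cas :: "real^8 \<Rightarrow> real^8 \<Rightarrow> real" where
  "cas x u = cos (u \<bullet> x) + sin (u \<bullet> x)"

lemma cas_measurable [measurable]: "cas x \<in> borel_measurable borel"
  unfolding cas_def by measurable

lemma abs_cas_le: "\<bar>cas x u\<bar> \<le> 2"
  unfolding cas_def using abs_cos_le_one[of "u \<bullet> x"] abs_sin_le_one[of "u \<bullet> x"] by linarith

text \<open>The product of two kernels is cos(u . (x - y)) + sin(u . (x + y)); the sine part
  integrates to zero and the cosine part detects \<open>x = y\<close>.\<close>

lemma integral_cas_cas:
  assumes "x \<in> int_lattice" "y \<in> int_lattice"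
  shows "(LINT u|cube_measure. cas x u * cas y u) = (if x = y then (2 * pi) ^ 8 else 0)"
proof -
  have *: "cas x u * cas y u = cos (u \<bullet> (x - y)) + sin (u \<bullet> (x + y))" for u
    by (simp add: cas_def inner_diff_right inner_add_right cos_diff sin_add algebra_simps)
  have "integrable cube_measure (\<lambda>u. cos (u \<bullet> (x - y)))" "integrable cube_measure (\<lambda>u. sin (u \<bullet> (x + y)))"
    by (rule integrable_cube_bounded[of _ 1]; simp)+
  moreover have "x - y \<in> int_lattice" "x + y \<in> int_lattice"
    using assms by (auto simp: int_lattice_def)
  ultimately show ?thesis
    unfolding * by (simp add: integral_cos_cube integral_sin_cube)
qed

lemma integrable_mult_cas:
  assumes meas [measurable]: "\<phi> \<in> borel_measurable borel"
    and sq: "integrable cube_measure (\<lambda>u. (\<phi> u)\<^sup>2)"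
  shows "integrable cube_measure (\<lambda>u. \<phi> u * cas x u)"
proof (rule Bochner_Integration.integrable_bound)
  show "integrable cube_measure (\<lambda>u. 2 * ((\<phi> u)\<^sup>2 + 1))"
    using sq by auto
  show "(\<lambda>u. \<phi> u * cas x u) \<in> borel_measurable cube_measure"
    by (rule cube_measurable) measurable
  have "\<bar>\<phi> u\<bar> \<le> (\<phi> u)\<^sup>2 + 1" for u
    using zero_le_power2[of "\<bar>\<phi> u\<bar> - 1"] zero_le_power2[of "\<phi> u"]
    by (simp add: power2_diff)
  then have "\<bar>\<phi> u * cas x u\<bar> \<le> ((\<phi> u)\<^sup>2 + 1) * 2" for u
    unfolding abs_mult using abs_cas_le by (intro mult_mono) auto
  then show "AE u in cube_measure. norm (\<phi> u * cas x u) \<le> norm (2 * ((\<phi> u)\<^sup>2 + 1))"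
    by (intro AE_I2) (simp add: mult.commute)
qed

text \<open>Bessel's inequality: the squared distance of \<phi> from its projection onto the span of
  the \<open>cas x\<close> is nonnegative, and orthogonality evaluates it. The constant
  \<open>W\<close> in the proof is the common squared norm of the kernels.\<close>

lemma bessel_cas:
  assumes meas [measurable]: "\<phi> \<in> borel_measurable borel"
    and sq: "integrable cube_measure (\<lambda>u. (\<phi> u)\<^sup>2)"
    and A: "finite A" "A \<subseteq> int_lattice"
  shows "(\<Sum>x\<in>A. (LINT u|cube_measure. \<phi> u * cas x u)\<^sup>2)
    \<le> (2 * pi) ^ 8 * (LINT u|cube_measure. (\<phi> u)\<^sup>2)"
proof -
  define c where "c x = (LINT u|cube_measure. \<phi> u * cas x u)" for x
  define W :: real where "W = (2 * pi) ^ 8"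
  have W: "W > 0" by (simp add: W_def)
  have int1: "integrable cube_measure (\<lambda>u. \<phi> u * cas x u)" for x
    using meas sq by (rule integrable_mult_cas)
  have int2: "integrable cube_measure (\<lambda>u. cas x u * cas y u)" for x y
  proof (rule integrable_cube_bounded[of _ "2 * 2"])
    show "norm (cas x u * cas y u) \<le> 2 * 2" for u
      unfolding real_norm_def abs_mult by (intro mult_mono abs_cas_le) auto
  qed measurable
  have cas_W: "(LINT u|cube_measure. cas x u * cas y u) = (if x = y then W else 0)" if "x \<in> A" "y \<in> A" for x y
    unfolding W_def using that A(2) by (intro integral_cas_cas) auto
  have "0 \<le> (LINT u|cube_measure. (\<phi> u - (\<Sum>x\<in>A. c x / W * cas x u))\<^sup>2)"
    by (rule integral_nonneg_AE) simp
  also have "\<dots> = (LINT u|cube_measure. (\<phi> u)\<^sup>2 - (\<Sum>x\<in>A. (2 * c x / W) * (\<phi> u * cas x u))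
      + (\<Sum>x\<in>A. \<Sum>y\<in>A. (c x / W * (c y / W)) * (cas x u * cas y u)))"
  proof (rule Bochner_Integration.integral_cong[OF refl])
    fix u
    define s where "s = (\<Sum>x\<in>A. c x / W * cas x u)"
    have "(\<phi> u - s)\<^sup>2 = (\<phi> u)\<^sup>2 - 2 * \<phi> u * s + s * s"
      by (simp add: power2_eq_square algebra_simps)
    moreover have "2 * \<phi> u * s = (\<Sum>x\<in>A. (2 * c x / W) * (\<phi> u * cas x u))"
      by (simp add: s_def sum_distrib_left mult_ac)
    moreover have "s * s = (\<Sum>x\<in>A. \<Sum>y\<in>A. (c x / W * (c y / W)) * (cas x u * cas y u))"
      by (simp add: s_def sum_product mult_ac)
    ultimately show "(\<phi> u - (\<Sum>x\<in>A. c x / W * cas x u))\<^sup>2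
      = (\<phi> u)\<^sup>2 - (\<Sum>x\<in>A. (2 * c x / W) * (\<phi> u * cas x u))
        + (\<Sum>x\<in>A. \<Sum>y\<in>A. (c x / W * (c y / W)) * (cas x u * cas y u))"
      by (simp add: s_def)
  qed
  also have "\<dots> = (LINT u|cube_measure. (\<phi> u)\<^sup>2) - (\<Sum>x\<in>A. (2 * c x / W) * c x)
      + (\<Sum>x\<in>A. \<Sum>y\<in>A. (c x / W * (c y / W)) * (LINT u|cube_measure. cas x u * cas y u))"
    using sq int1 int2 by (simp add: c_def)
  also have "(\<Sum>x\<in>A. \<Sum>y\<in>A. (c x / W * (c y / W)) * (LINT u|cube_measure. cas x u * cas y u))
      = (\<Sum>x\<in>A. \<Sum>y\<in>A. if x = y then (c x)\<^sup>2 / W else 0)"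
    using W
    by (intro sum.cong refl) (auto simp: cas_W power2_eq_square)
  also have "\<dots> = (\<Sum>x\<in>A. (c x)\<^sup>2) / W"
    using A(1) by (simp add: sum_divide_distrib)
  also have "(\<Sum>x\<in>A. (2 * c x / W) * c x) = 2 * ((\<Sum>x\<in>A. (c x)\<^sup>2) / W)"
    by (simp add: sum_divide_distrib sum_distrib_left power2_eq_square mult_ac)
  finally have "(\<Sum>x\<in>A. (c x)\<^sup>2) / W \<le> (LINT u|cube_measure. (\<phi> u)\<^sup>2)"
    by simp
  then show ?thesis
    using W by (simp add: c_def W_def field_simps)
qed

text \<open>A Riemann-Lebesgue statement in finiteness form. Infinitely many large
  \<open>cas\<close> coefficients would give finite sets whose sums of squares exceed the Bessel
  bound.\<close>

lemma finite_large_sin_coefficients: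
  assumes meas [measurable]: "\<phi> \<in> borel_measurable borel"
    and sq: "integrable cube_measure (\<lambda>u. (\<phi> u)\<^sup>2)"
    and "0 < \<epsilon>"
  shows "finite {x \<in> int_lattice. \<epsilon> \<le> \<bar>LINT u|cube_measure. \<phi> u * sin (u \<bullet> x)\<bar>}"
proof -
  define c where "c x = (LINT u|cube_measure. \<phi> u * cas x u)" for x
  define N where "N = (2 * pi) ^ 8 * (LINT u|cube_measure. (\<phi> u)\<^sup>2)"
  have int1: "integrable cube_measure (\<lambda>u. \<phi> u * cas x u)" for x
    using meas sq by (rule integrable_mult_cas)
  have fin: "finite {x \<in> int_lattice. \<epsilon> \<le> \<bar>c x\<bar>}"
  proof (rule ccontr)
    assume inf: "infinite {x \<in> int_lattice. \<epsilon> \<le> \<bar>c x\<bar>}"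
    obtain n :: nat where n: "N / \<epsilon>\<^sup>2 < n" using reals_Archimedean2 by blast
    obtain A where A: "finite A" "card A = n" "A \<subseteq> {x \<in> int_lattice. \<epsilon> \<le> \<bar>c x\<bar>}"
      using infinite_arbitrarily_large[OF inf] by blast
    have "of_nat (card A) * \<epsilon>\<^sup>2 \<le> (\<Sum>x\<in>A. (c x)\<^sup>2)"
    proof (rule sum_bounded_below)
      fix x assume "x \<in> A"
      then have "\<epsilon> \<le> \<bar>c x\<bar>" using A by auto
      then show "\<epsilon>\<^sup>2 \<le> (c x)\<^sup>2" using assms(3) by (metis abs_le_square_iff abs_of_pos)
    qed
    also have "\<dots> \<le> N"
      unfolding c_def N_def using A by (intro bessel_cas assms) auto
    finally show False using n A(2) assms(3) by (simp add: field_simps)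
  qed
  \<comment> \<open>The sine is the odd part of the kernel in \<open>x\<close>, so a large sine
    coefficient at \<open>x\<close> forces a large \<open>cas\<close> coefficient at
    \<open>x\<close> or at \<open>-x\<close>.\<close>
  have split: "(LINT u|cube_measure. \<phi> u * sin (u \<bullet> x)) = (c x - c (-x)) / 2" for x
  proof -
    have "(LINT u|cube_measure. \<phi> u * sin (u \<bullet> x)) = (LINT u|cube_measure. (\<phi> u * cas x u - \<phi> u * cas (-x) u) / 2)"
      by (rule Bochner_Integration.integral_cong[OF refl]) (simp add: cas_def algebra_simps)
    then show ?thesis using int1 by (simp add: c_def)
  qed
  have "{x \<in> int_lattice. \<epsilon> \<le> \<bar>LINT u|cube_measure. \<phi> u * sin (u \<bullet> x)\<bar>}
      \<subseteq> {x \<in> int_lattice. \<epsilon> \<le> \<bar>c x\<bar>} \<union> uminus ` {x \<in> int_lattice. \<epsilon> \<le> \<bar>c x\<bar>}"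
  proof
    fix x assume x: "x \<in> {x \<in> int_lattice. \<epsilon> \<le> \<bar>LINT u|cube_measure. \<phi> u * sin (u \<bullet> x)\<bar>}"
    then have "2 * \<epsilon> \<le> \<bar>c x - c (-x)\<bar>"
      unfolding split by simp
    then have "\<epsilon> \<le> \<bar>c x\<bar> \<or> \<epsilon> \<le> \<bar>c (-x)\<bar>"
      using abs_triangle_ineq4[of "c x" "c (-x)"] by (smt (verit))
    moreover have "-x \<in> int_lattice" using x by (auto simp: int_lattice_def)
    ultimately show "x \<in> {x \<in> int_lattice. \<epsilon> \<le> \<bar>c x\<bar>} \<union> uminus ` {x \<in> int_lattice. \<epsilon> \<le> \<bar>c x\<bar>}"
      using x by (auto intro: image_eqI[of _ _ "-x"])
  qed
  then show ?thesis using fin by (meson finite_UnI finite_imageI finite_subset)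
qed

section \<open>The fundamental solution\<close>

text \<open>Up to the sign of conjugation these are the coordinates of \<open>E1\<close>, written
  with the Lebesgue integral so that the Fourier lemmas apply.\<close>

definition Ecomp :: "8 \<Rightarrow> real^8 \<Rightarrow> real" where
  "Ecomp i x = 1 / (2 * pi) ^ 8 * (LINT u|cube_measure. sin (u $ i) / symb u * sin (u \<bullet> x))"

lemma sin_sq_le_symb: "(sin (u $ i))\<^sup>2 \<le> symb u"
  unfolding symb_def by (rule member_le_sum) auto

lemma symb_nonneg: "0 \<le> symb u"
  unfolding symb_def by (simp add: sum_nonneg)

lemma square_sin_div_symb_le: "(sin (u $ i) / symb u)\<^sup>2 \<le> 1 / symb u"
proof -
  have "(sin (u $ i))\<^sup>2 / (symb u)\<^sup>2 \<le> symb u / (symb u)\<^sup>2"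
    by (intro divide_right_mono sin_sq_le_symb) simp
  then show ?thesis by (cases "symb u = 0") (simp_all add: power_divide power2_eq_square)
qed

text \<open>One factor of the symbol is absorbed by the squared sine, leaving the integrable
  majorant 1 / \<open>symb u\<close>. This is the square integrability that Bessel's inequality
  requires.\<close>

lemma integrable_square_sin_div_symb: "integrable cube_measure (\<lambda>u. (sin (u $ i) / symb u)\<^sup>2)"
proof (rule Bochner_Integration.integrable_bound[OF integrable_inverse_symb])
  show "(\<lambda>u. (sin (u $ i) / symb u)\<^sup>2) \<in> borel_measurable cube_measure"
    by (rule cube_measurable) measurable
  show "AE u in cube_measure. norm ((sin (u $ i) / symb u)\<^sup>2) \<le> norm (1 / symb u)"
    using square_sin_div_symb_le symb_nonneg by (intro AE_I2) (simp add: symb_nonneg)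
qed

lemma integrable_div_symb:
  assumes [measurable]: "g \<in> borel_measurable borel" and g: "\<And>u. \<bar>g u\<bar> \<le> (1::real)"
  shows "integrable cube_measure (\<lambda>u. g u / symb u)"
proof (rule Bochner_Integration.integrable_bound[OF integrable_inverse_symb])
  show "(\<lambda>u. g u / symb u) \<in> borel_measurable cube_measure"
    by (rule cube_measurable) measurable
  show "AE u in cube_measure. norm (g u / symb u) \<le> norm (1 / symb u)"
    using g symb_nonneg by (intro AE_I2) (simp add: divide_right_mono abs_divide)
qed

lemma integrable_sin_sin_div_symb: "integrable cube_measure (\<lambda>u. sin (u $ i) / symb u * sin (u \<bullet> x))"
  using integrable_div_symb[of "\<lambda>u. sin (u $ i) * sin (u \<bullet> x)"]
  by (simp add: abs_mult mult_le_one)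

lemma integrable_sin_sin_cos_div_symb: "integrable cube_measure (\<lambda>u. sin (u $ i) * sin (u $ j) * cos (u \<bullet> x) / symb u)"
  by (rule integrable_div_symb) (measurable, simp add: abs_mult mult_le_one)

text \<open>The identity sin(a + b) - sin(a - b) = 2 cos a sin b with b = \<open>u $ j\<close>
  produces the second sine factor. The resulting integrand is visibly symmetric in \<open>i\<close>
  and \<open>j\<close>.\<close>

lemma Ecomp_central_difference:
  "Ecomp i (x + axis j 1) - Ecomp i (x - axis j 1)
     = 2 / (2 * pi) ^ 8 * (LINT u|cube_measure. sin (u $ i) * sin (u $ j) * cos (u \<bullet> x) / symb u)"
proof -
  have "Ecomp i (x + axis j 1) - Ecomp i (x - axis j 1)
     = 1 / (2 * pi) ^ 8 * (LINT u|cube_measure. sin (u $ i) / symb u * sin (u \<bullet> (x + axis j 1))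
          - sin (u $ i) / symb u * sin (u \<bullet> (x - axis j 1)))"
    unfolding Ecomp_def
    by (subst Bochner_Integration.integral_diff)
       (simp_all add: integrable_sin_sin_div_symb right_diff_distrib del: times_divide_eq_left times_divide_eq_right)
  also have "(LINT u|cube_measure. sin (u $ i) / symb u * sin (u \<bullet> (x + axis j 1))
          - sin (u $ i) / symb u * sin (u \<bullet> (x - axis j 1)))
     = (LINT u|cube_measure. 2 * (sin (u $ i) * sin (u $ j) * cos (u \<bullet> x) / symb u))"
    by (rule Bochner_Integration.integral_cong[OF refl])
       (simp add: inner_add_right inner_diff_right inner_axis sin_add sin_diff add_divide_distrib diff_divide_distrib algebra_simps)
  also have "\<dots> = 2 * (LINT u|cube_measure. sin (u $ i) * sin (u $ j) * cos (u \<bullet> x) / symb u)"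
    by (rule integral_mult_right_zero)
  finally show ?thesis by simp
qed

lemma Ecomp_central_difference_sym:
  "Ecomp i (x + axis j 1) - Ecomp i (x - axis j 1) = Ecomp j (x + axis i 1) - Ecomp j (x - axis i 1)"
  unfolding Ecomp_central_difference by (simp add: mult_ac)

text \<open>Summing over \<open>i\<close> cancels the symbol almost everywhere and leaves the
  Fourier integral of the delta function. The value is 2 because the differences are not divided by
  the double step.\<close>

lemma Ecomp_divergence:
  assumes "x \<in> int_lattice"
  shows "(\<Sum>i\<in>UNIV. Ecomp i (x + axis i 1) - Ecomp i (x - axis i 1)) = (if x = 0 then 2 else 0)"
proof -
  have "(\<Sum>i\<in>UNIV. LINT u|cube_measure. sin (u $ i) * sin (u $ i) * cos (u \<bullet> x) / symb u)
      = (LINT u|cube_measure. (\<Sum>i\<in>UNIV. sin (u $ i) * sin (u $ i) * cos (u \<bullet> x) / symb u))"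
    by (rule Bochner_Integration.integral_sum[symmetric]) (rule integrable_sin_sin_cos_div_symb)
  also have "\<dots> = (LINT u|cube_measure. cos (u \<bullet> x))"
  proof (rule Bochner_Integration.integral_cong_AE)
    have "AE u in cube_measure. \<forall>i. sin (u $ i) \<noteq> 0"
      using AE_sin_nonzero by (auto simp: AE_restrict_space_iff)
    then show "AE u in cube_measure. (\<Sum>i\<in>UNIV. sin (u $ i) * sin (u $ i) * cos (u \<bullet> x) / symb u) = cos (u \<bullet> x)"
    proof eventually_elim
      case (elim u)
      have "symb u > 0" unfolding symb_def using elim by (intro sum_pos) auto
      moreover have "(\<Sum>i\<in>UNIV. sin (u $ i) * sin (u $ i) * cos (u \<bullet> x) / symb u) = symb u * cos (u \<bullet> x) / symb u"
        by (simp add: symb_def power2_eq_square sum_distrib_right sum_divide_distrib)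
      ultimately show ?case by simp
    qed
  qed (rule cube_measurable; measurable)+
  also have "\<dots> = (if x = 0 then (2 * pi) ^ 8 else 0)"
    by (rule integral_cos_cube[OF assms])
  finally have "(\<Sum>i\<in>UNIV. LINT u|cube_measure. sin (u $ i) * sin (u $ i) * cos (u \<bullet> x) / symb u)
      = (if x = 0 then (2 * pi) ^ 8 else 0)" .
  then show ?thesis
    unfolding Ecomp_central_difference sum_distrib_left[symmetric] by simp
qed

lemma finite_large_Ecomp:
  assumes "0 < \<epsilon>"
  shows "finite {x \<in> int_lattice. \<epsilon> \<le> \<bar>Ecomp i x\<bar>}"
proof -
  have "finite {x \<in> int_lattice. \<epsilon> * (2 * pi) ^ 8 \<le> \<bar>LINT u|cube_measure. sin (u $ i) / symb u * sin (u \<bullet> x)\<bar>}"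
    using assms by (intro finite_large_sin_coefficients integrable_square_sin_div_symb) auto
  then show ?thesis
    by (rule rev_finite_subset) (auto simp: Ecomp_def abs_mult field_simps)
qed

text \<open>\<open>E1\<close> uses the gauge integral of a vector-valued function. Absolute
  integrability of every coordinate makes it agree with the Lebesgue integrals in
  \<open>Ecomp\<close>.\<close>

lemma E1_nth: "E1 x $ j = (if j = ix 0 then 1 else -1) * Ecomp j x"
proof -
  define g where "g u = (sin (u \<bullet> x) / (\<Sum>i\<in>UNIV. (sin (u $ i))\<^sup>2)) *\<^sub>R
          (\<chi> j. (if j = ix 0 then 1 else -1) * sin (u $ j))" for u :: "real^8"
  have nth: "g u $ j = (if j = ix 0 then 1 else -1) * (sin (u $ j) / symb u * sin (u \<bullet> x))" for u j
    by (simp add: g_def symb_def)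
  have si: "set_integrable lborel cube (\<lambda>u. g u $ j)" for j
    using integrable_mult_right[OF integrable_sin_sin_div_symb[of j x], of "if j = ix 0 then 1 else -1"]
    unfolding nth set_integrable_def
    by (subst (asm) integrable_restrict_space) auto
  have "(\<lambda>u. g u $ j) integrable_on cube" for j
    by (rule set_borel_integral_eq_integral[OF si])
  then have "g integrable_on cube"
    by (subst integrable_componentwise_iff) (auto simp: Basis_eq_axis inner_axis)
  then have "integral cube g $ j = integral cube (\<lambda>u. g u $ j)"
    using integral_component_eq_cart by metis
  also have "\<dots> = (LINT u:cube|lborel. g u $ j)"
    using set_borel_integral_eq_integral(2)[OF si] by simp
  also have "\<dots> = (LINT u|cube_measure. g u $ j)"
    unfolding set_lebesgue_integral_def by (subst integral_restrict_space) auto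
  also have "\<dots> = (if j = ix 0 then 1 else -1) * (LINT u|cube_measure. sin (u $ j) / symb u * sin (u \<bullet> x))"
    unfolding nth by (rule integral_mult_right_zero)
  finally show ?thesis
    by (simp add: E1_def Ecomp_def g_def[abs_def])
qed

text \<open>Adding the double sum to its transpose leaves only symmetrised terms, which is the shape
  in which the polar identities can be applied.\<close>

lemma sum_symmetric_pairs:
  fixes M :: "'i \<Rightarrow> 'i \<Rightarrow> 'a::real_vector"
  assumes "finite I" and "\<And>k l. k \<in> I \<Longrightarrow> l \<in> I \<Longrightarrow> M k l + M l k = (if k = l then 2 *\<^sub>R a k else 0)"
  shows "(\<Sum>k\<in>I. \<Sum>l\<in>I. M k l) = (\<Sum>k\<in>I. a k)"
proof -
  have "2 *\<^sub>R (\<Sum>k\<in>I. \<Sum>l\<in>I. M k l) = (\<Sum>k\<in>I. \<Sum>l\<in>I. M k l) + (\<Sum>k\<in>I. \<Sum>l\<in>I. M l k)"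
    by (subst (2) sum.swap) (simp add: scaleR_2)
  also have "\<dots> = (\<Sum>k\<in>I. \<Sum>l\<in>I. M k l + M l k)"
    by (simp add: sum.distrib)
  also have "\<dots> = (\<Sum>k\<in>I. \<Sum>l\<in>I. if k = l then 2 *\<^sub>R a k else 0)"
    by (intro sum.cong refl) (simp add: assms(2))
  also have "\<dots> = 2 *\<^sub>R (\<Sum>k\<in>I. a k)"
    using assms(1) by (simp add: scaleR_right.sum)
  finally show ?thesis by simp
qed

section \<open>Octonionic difference identities for the fundamental solution\<close>

lemma omul_E1: "omul (E1 x) a = (\<Sum>k<8. (csgn k * Ecomp (ix k) x) *\<^sub>R omul (ebas k) a)"
proof -
  have "E1 x = (\<Sum>k<8. (csgn k * Ecomp (ix k) x) *\<^sub>R ebas k)"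
    by (subst oct_expand, rule sum.cong[OF refl]) (auto simp: E1_nth csgn_def ix_eq_iff)
  then show ?thesis by (simp add: omul.sum_left omul.scaleR_left)
qed

lemma omul_E1_difference:
  "omul (E1 (x + ebas l) - E1 (x - ebas l)) a
    = (\<Sum>k<8. (csgn k * (Ecomp (ix k) (x + ebas l) - Ecomp (ix k) (x - ebas l))) *\<^sub>R omul (ebas k) a)"
  by (simp add: omul.diff_left omul_E1 right_diff_distrib scaleR_diff_left sum_subtractf)

lemma sum_Ecomp_divergence:
  fixes a :: "'a::real_vector"
  assumes "x \<in> int_lattice"
  shows "(\<Sum>l<8. (Ecomp (ix l) (x + ebas l) - Ecomp (ix l) (x - ebas l)) *\<^sub>R a) = (if x = 0 then 2 else 0) *\<^sub>R a"
proof -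
  have "(\<Sum>l<8. Ecomp (ix l) (x + ebas l) - Ecomp (ix l) (x - ebas l)) = (if x = 0 then 2 else 0)"
    using Ecomp_divergence[OF assms] unfolding sum_UNIV_ix ebas_def .
  then show ?thesis by (simp only: scaleR_sum_left[symmetric])
qed

text \<open>The symmetry of \<open>c\<close> pairs the terms (k, l) and (l, k), so
  \<open>omul_conj_polar\<close> reduces the sum to its diagonal, the divergence. Here the unit
  stands between kernel and value, as in the star product.\<close>

lemma E1_difference_omul_right:
  assumes "x \<in> int_lattice"
  shows "(\<Sum>l<8. omul (E1 (x + ebas l) - E1 (x - ebas l)) (omul (ebas l) a)) = (if x = 0 then 2 else 0) *\<^sub>R a"
proof -
  define c where "c k l = Ecomp (ix k) (x + ebas l) - Ecomp (ix k) (x - ebas l)" for k l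
  have c_sym: "c k l = c l k" for k l
    unfolding c_def ebas_def by (rule Ecomp_central_difference_sym)
  have "(\<Sum>l<8. omul (E1 (x + ebas l) - E1 (x - ebas l)) (omul (ebas l) a))
      = (\<Sum>l<8. \<Sum>k<8. (csgn k * c k l) *\<^sub>R omul (ebas k) (omul (ebas l) a))"
    by (simp add: omul_E1_difference c_def)
  also have "\<dots> = (\<Sum>l<8. c l l *\<^sub>R a)"
  proof (rule sum_symmetric_pairs)
    fix l k :: nat assume "l \<in> {..<8}" "k \<in> {..<8}"
    then have *: "csgn k *\<^sub>R omul (ebas k) (omul (ebas l) a) + csgn l *\<^sub>R omul (ebas l) (omul (ebas k) a)
           = (if k = l then 2 *\<^sub>R a else 0)"
      by (intro omul_conj_polar) auto
    have "(csgn k * c k l) *\<^sub>R omul (ebas k) (omul (ebas l) a) + (csgn l * c l k) *\<^sub>R omul (ebas l) (omul (ebas k) a)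
        = c l k *\<^sub>R (csgn k *\<^sub>R omul (ebas k) (omul (ebas l) a) + csgn l *\<^sub>R omul (ebas l) (omul (ebas k) a))"
      by (simp add: c_sym[of k l] scaleR_add_right mult.commute)
    then show "(csgn k * c k l) *\<^sub>R omul (ebas k) (omul (ebas l) a) + (csgn l * c l k) *\<^sub>R omul (ebas l) (omul (ebas k) a)
        = (if l = k then 2 *\<^sub>R (c l l *\<^sub>R a) else 0)"
      unfolding * by auto
  qed simp
  finally show ?thesis
    by (simp add: c_def sum_Ecomp_divergence[OF assms])
qed

text \<open>The same pairing with \<open>omul_conj_polar'\<close>. With the unit outermost, it says
  that the kernel times a constant is a fundamental solution of D^h.\<close>

lemma omul_left_E1_difference:
  assumes "x \<in> int_lattice"
  shows "(\<Sum>l<8. omul (ebas l) (omul (E1 (x + ebas l) - E1 (x - ebas l)) a)) = (if x = 0 then 2 else 0) *\<^sub>R a"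
proof -
  define c where "c k l = Ecomp (ix k) (x + ebas l) - Ecomp (ix k) (x - ebas l)" for k l
  have c_sym: "c k l = c l k" for k l
    unfolding c_def ebas_def by (rule Ecomp_central_difference_sym)
  have "(\<Sum>l<8. omul (ebas l) (omul (E1 (x + ebas l) - E1 (x - ebas l)) a))
      = (\<Sum>l<8. \<Sum>k<8. (csgn k * c k l) *\<^sub>R omul (ebas l) (omul (ebas k) a))"
    by (simp add: omul_E1_difference c_def omul.sum_right omul.scaleR_right)
  also have "\<dots> = (\<Sum>l<8. c l l *\<^sub>R a)"
  proof (rule sum_symmetric_pairs)
    fix l k :: nat assume "l \<in> {..<8}" "k \<in> {..<8}"
    then have *: "csgn k *\<^sub>R omul (ebas l) (omul (ebas k) a) + csgn l *\<^sub>R omul (ebas k) (omul (ebas l) a)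
           = (if k = l then 2 *\<^sub>R a else 0)"
      by (intro omul_conj_polar') auto
    have "(csgn k * c k l) *\<^sub>R omul (ebas l) (omul (ebas k) a) + (csgn l * c l k) *\<^sub>R omul (ebas k) (omul (ebas l) a)
        = c l k *\<^sub>R (csgn k *\<^sub>R omul (ebas l) (omul (ebas k) a) + csgn l *\<^sub>R omul (ebas k) (omul (ebas l) a))"
      by (simp add: c_sym[of k l] scaleR_add_right mult.commute)
    then show "(csgn k * c k l) *\<^sub>R omul (ebas l) (omul (ebas k) a) + (csgn l * c l k) *\<^sub>R omul (ebas k) (omul (ebas l) a)
        = (if l = k then 2 *\<^sub>R (c l l *\<^sub>R a) else 0)"
      unfolding * by auto
  qed simp
  finally show ?thesis
    by (simp add: c_def sum_Ecomp_divergence[OF assms])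
qed

section \<open>The rescaled lattice and kernel\<close>

lemma Zh_iff: "h \<noteq> 0 \<Longrightarrow> x \<in> Zh h \<longleftrightarrow> (1 / h) *\<^sub>R x \<in> int_lattice"
  by (auto simp: Zh_def int_lattice_def Ints_def field_simps image_iff)

lemma Zh_add: "x \<in> Zh h \<Longrightarrow> y \<in> Zh h \<Longrightarrow> x + y \<in> Zh h"
  unfolding Zh_def by simp (metis distrib_left of_int_add)

lemma Zh_diff: "x \<in> Zh h \<Longrightarrow> y \<in> Zh h \<Longrightarrow> x - y \<in> Zh h"
  unfolding Zh_def by simp (metis right_diff_distrib of_int_diff)

lemma Zh_step: "h *\<^sub>R ebas l \<in> Zh h"
  unfolding Zh_def ebas_def axis_def by (auto intro: exI[of _ 0] exI[of _ 1])

lemma Zh_shift: "x \<in> Zh h \<Longrightarrow> x + h *\<^sub>R ebas l \<in> Zh h" "x \<in> Zh h \<Longrightarrow> x - h *\<^sub>R ebas l \<in> Zh h"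
  by (simp_all add: Zh_add Zh_diff Zh_step)

lemma Eh_shift:
  assumes "h \<noteq> 0"
  shows "Eh h (x + h *\<^sub>R ebas l) = (1 / h ^ 7) *\<^sub>R E1 ((1 / h) *\<^sub>R x + ebas l)"
    and "Eh h (x - h *\<^sub>R ebas l) = (1 / h ^ 7) *\<^sub>R E1 ((1 / h) *\<^sub>R x - ebas l)"
  using assms by (simp_all add: Eh_def scaleR_add_right scaleR_diff_right)

lemma Eh_difference_omul_right:
  assumes "h \<noteq> 0" "x \<in> Zh h"
  shows "(\<Sum>l<8. omul (Eh h (x + h *\<^sub>R ebas l) - Eh h (x - h *\<^sub>R ebas l)) (omul (ebas l) a))
    = (if x = 0 then 2 / h ^ 7 else 0) *\<^sub>R a"
proof -
  have "(1 / h) *\<^sub>R x \<in> int_lattice" using assms Zh_iff by blast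
  from E1_difference_omul_right[OF this, of a] show ?thesis
    using assms(1)
    by (simp add: Eh_shift omul.scaleR_left flip: scaleR_diff_right scaleR_right.sum)
qed

lemma omul_left_Eh_difference:
  assumes "h \<noteq> 0" "x \<in> Zh h"
  shows "(\<Sum>l<8. omul (ebas l) (omul (Eh h (x + h *\<^sub>R ebas l) - Eh h (x - h *\<^sub>R ebas l)) a))
    = (if x = 0 then 2 / h ^ 7 else 0) *\<^sub>R a"
proof -
  have "(1 / h) *\<^sub>R x \<in> int_lattice" using assms Zh_iff by blast
  from omul_left_E1_difference[OF this, of a] show ?thesis
    using assms(1)
    by (simp add: Eh_shift omul.scaleR_left omul.scaleR_right flip: scaleR_diff_right scaleR_right.sum)
qed

lemma finite_bounded_Zh:
  assumes "h > 0" "A \<subseteq> Zh h" "bounded A"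
  shows "finite A"
proof -
  obtain C where C: "\<And>x. x \<in> A \<Longrightarrow> norm x \<le> C" using assms(3) by (auto simp: bounded_iff)
  define S where "S = (\<lambda>k::int. h * of_int k) ` {-\<lceil>C / h\<rceil>..\<lceil>C / h\<rceil>}"
  have "x $ i \<in> S" if x: "x \<in> A" for x i
  proof -
    obtain k :: int where k: "x $ i = h * of_int k" using x assms(2) by (auto simp: Zh_def)
    have "h * \<bar>of_int k\<bar> \<le> C"
      using component_le_norm_cart[of x i] C[OF x] k assms(1) by (simp add: abs_mult)
    then have "\<bar>of_int k\<bar> \<le> C / h" using assms(1) by (simp add: field_simps)
    then have "k \<in> {-\<lceil>C / h\<rceil>..\<lceil>C / h\<rceil>}" by (auto simp: abs_le_iff) linarith+
    then show ?thesis using k by (auto simp: S_def)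
  qed
  then have "vec_nth ` A \<subseteq> PiE UNIV (\<lambda>_. S)" by auto
  moreover have "finite (PiE (UNIV :: 8 set) (\<lambda>_. S))"
    by (intro finite_PiE) (auto simp: S_def)
  ultimately have "finite (vec_nth ` A)" by (rule finite_subset)
  then show ?thesis
    by (rule finite_imageD) (auto simp: inj_on_def vec_nth_inject)
qed

text \<open>For each coordinate only finitely many lattice points carry a large value, and a ball
  contains all of these exceptional points.\<close>

lemma Eh_tendsto_zero:
  assumes "h > 0" "\<epsilon> > 0"
  shows "\<exists>R. \<forall>x\<in>Zh h. norm x > R \<longrightarrow> norm (Eh h x) < \<epsilon>"
proof -
  \<comment> \<open>The 8 pays for bounding the norm by the sum of eight coordinates, and
    \<open>h ^ 7\<close> undoes the scaling in \<open>Eh\<close>.\<close>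
  define \<delta> where "\<delta> = \<epsilon> * h ^ 7 / 8"
  have \<delta>: "\<delta> > 0" using assms by (simp add: \<delta>_def)
  define X where "X = (\<Union>i. (\<lambda>x. h *\<^sub>R x) ` {x \<in> int_lattice. \<delta> \<le> \<bar>Ecomp i x\<bar>})"
  have "finite X"
    unfolding X_def using finite_large_Ecomp[OF \<delta>] by auto
  then have "bounded X" by (rule finite_imp_bounded)
  then obtain R where R: "\<And>x. x \<in> X \<Longrightarrow> norm x \<le> R" by (auto simp: bounded_iff)
  have "norm (Eh h x) < \<epsilon>" if x: "x \<in> Zh h" "norm x > R" for x
  proof -
    define y where "y = (1 / h) *\<^sub>R x"
    have y: "y \<in> int_lattice" "x = h *\<^sub>R y" using x(1) Zh_iff[of h x] assms by (auto simp: y_def)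
    have "x \<notin> X" using R x(2) by force
    then have "y \<notin> {x \<in> int_lattice. \<delta> \<le> \<bar>Ecomp i x\<bar>}" for i
      unfolding X_def y(2) by blast
    then have small: "\<bar>Ecomp i y\<bar> < \<delta>" for i
      using y(1) by (simp add: not_le)
    have "norm (E1 y) \<le> (\<Sum>i\<in>UNIV. \<bar>E1 y $ i\<bar>)" by (rule norm_le_l1_cart)
    also have "\<dots> = (\<Sum>i\<in>UNIV. \<bar>Ecomp i y\<bar>)" by (intro sum.cong) (auto simp: E1_nth abs_mult)
    also have "\<dots> < (\<Sum>i\<in>(UNIV::8 set). \<delta>)" using small by (intro sum_strict_mono) auto
    finally have "norm (E1 y) < \<epsilon> * h ^ 7" by (simp add: \<delta>_def)
    then show ?thesis using assms by (simp add: Eh_def y_def[symmetric] field_simps)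
  qed
  then show ?thesis by blast
qed

section \<open>The volume potential\<close>

lemma dcent_eq: "h \<noteq> 0 \<Longrightarrow> dcent h l f x = (1 / (2 * h)) *\<^sub>R (f (x + h *\<^sub>R ebas l) - f (x - h *\<^sub>R ebas l))"
  by (simp add: dcent_def dplus_def dminus_def scaleR_add_right[symmetric])

lemma Dh_eq:
  assumes "h \<noteq> 0"
  shows "Dh h f x = (1 / (2 * h)) *\<^sub>R (\<Sum>l<8. omul (ebas l) (f (x + h *\<^sub>R ebas l) - f (x - h *\<^sub>R ebas l)))"
  using assms by (simp add: Dh_def dcent_eq omul.scaleR_right scaleR_right.sum)

text \<open>A discrete Teodorescu transform applied to D^h g; this is the operator V of the opening
  overview.\<close>

definition volpot :: "real \<Rightarrow> pt set \<Rightarrow> (pt \<Rightarrow> oct) \<Rightarrow> pt \<Rightarrow> oct" where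
  "volpot h B g y = h ^ 8 *\<^sub>R (\<Sum>z\<in>B. omul (Eh h (y - z)) (Dh h g z))"

text \<open>D^h falls on the kernel and produces a delta at \<open>y\<close>; the constants h^8,
  1/(2h) and 2/h^7 multiply to 1.\<close>

lemma Dh_volpot:
  assumes "h > 0" "finite B" "B \<subseteq> Zh h" "y \<in> Zh h"
  shows "Dh h (volpot h B g) y = (if y \<in> B then Dh h g y else 0)"
proof -
  have "Dh h (volpot h B g) y = (1 / (2 * h)) *\<^sub>R (\<Sum>l<8. omul (ebas l)
     (h ^ 8 *\<^sub>R (\<Sum>z\<in>B. omul (Eh h ((y - z) + h *\<^sub>R ebas l) - Eh h ((y - z) - h *\<^sub>R ebas l)) (Dh h g z))))"
    using assms(1)
    by (simp add: Dh_eq[of h "volpot h B g"] volpot_def omul.diff_left sum_subtractf scaleR_diff_right algebra_simps)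
  also have "\<dots> = (h ^ 7 / 2) *\<^sub>R (\<Sum>l<8. \<Sum>z\<in>B. omul (ebas l)
     (omul (Eh h ((y - z) + h *\<^sub>R ebas l) - Eh h ((y - z) - h *\<^sub>R ebas l)) (Dh h g z)))"
    using assms(1) by (simp add: omul.scaleR_right omul.sum_right eval_nat_numeral flip: scaleR_right.sum)
  also have "\<dots> = (h ^ 7 / 2) *\<^sub>R (\<Sum>z\<in>B. \<Sum>l<8. omul (ebas l)
     (omul (Eh h ((y - z) + h *\<^sub>R ebas l) - Eh h ((y - z) - h *\<^sub>R ebas l)) (Dh h g z)))"
    by (subst sum.swap) simp
  also have "\<dots> = (h ^ 7 / 2) *\<^sub>R (\<Sum>z\<in>B. (if y - z = 0 then 2 / h ^ 7 else 0) *\<^sub>R Dh h g z)"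
    using assms by (intro arg_cong[where f = "\<lambda>s. (h ^ 7 / 2) *\<^sub>R s"] sum.cong refl omul_left_Eh_difference) (auto intro: Zh_diff)
  also have "\<dots> = (h ^ 7 / 2) *\<^sub>R (\<Sum>z\<in>B. if z = y then (2 / h ^ 7) *\<^sub>R Dh h g y else 0)"
    by (intro arg_cong[where f = "\<lambda>s. (h ^ 7 / 2) *\<^sub>R s"] sum.cong refl) auto
  also have "\<dots> = (if y \<in> B then Dh h g y else 0)"
    using assms(1,2) by simp
  finally show ?thesis .
qed

lemma volpot_tendsto_zero:
  assumes "h > 0" "finite B" "B \<subseteq> Zh h" "\<epsilon> > 0"
  shows "\<exists>R. \<forall>y\<in>Zh h. norm y > R \<longrightarrow> norm (volpot h B g y) < \<epsilon>"
proof -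
  obtain K where K: "K > 0" "\<And>a b. norm (omul a b) \<le> norm a * norm b * K"
    using omul.pos_bounded by blast
  define C where "C = h ^ 8 * K * (\<Sum>z\<in>B. norm (Dh h g z))"
  have C: "C \<ge> 0" using K assms(1) by (simp add: C_def sum_nonneg)
  \<comment> \<open>The summand 1 keeps the quotient meaningful when \<open>C = 0\<close>.\<close>
  define \<delta> where "\<delta> = \<epsilon> / (C + 1)"
  have \<delta>: "\<delta> > 0" using assms(4) C by (simp add: \<delta>_def)
  obtain R where R: "\<And>x. x \<in> Zh h \<Longrightarrow> norm x > R \<Longrightarrow> norm (Eh h x) < \<delta>"
    using Eh_tendsto_zero[OF assms(1) \<delta>] by blast
  obtain R' where R': "\<And>z. z \<in> B \<Longrightarrow> norm z \<le> R'"
    using finite_imp_bounded[OF assms(2)] by (auto simp: bounded_iff)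
  have "norm (volpot h B g y) < \<epsilon>" if y: "y \<in> Zh h" "norm y > R + R'" for y
  proof -
    have "norm (omul (Eh h (y - z)) (Dh h g z)) \<le> \<delta> * norm (Dh h g z) * K" if z: "z \<in> B" for z
    proof -
      have "norm (y - z) > R" using y(2) R'[OF z] norm_triangle_ineq2[of y z] by linarith
      then have "norm (Eh h (y - z)) \<le> \<delta>"
        using R[of "y - z"] y z assms(3) by (auto intro!: Zh_diff less_imp_le)
      then have "norm (Eh h (y - z)) * norm (Dh h g z) * K \<le> \<delta> * norm (Dh h g z) * K"
        using K(1) by (intro mult_right_mono) auto
      then show ?thesis using K(2) order_trans by blast
    qed
    then have "norm (\<Sum>z\<in>B. omul (Eh h (y - z)) (Dh h g z)) \<le> (\<Sum>z\<in>B. \<delta> * norm (Dh h g z) * K)"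
      by (rule sum_norm_le)
    then have "norm (volpot h B g y) \<le> h ^ 8 * (\<Sum>z\<in>B. \<delta> * norm (Dh h g z) * K)"
      using assms(1) by (simp add: volpot_def)
    also have "\<dots> = \<delta> * C"
      by (simp add: C_def sum_distrib_left sum_distrib_right mult_ac)
    also have "\<dots> < \<epsilon>"
      using C assms(4) by (simp add: \<delta>_def field_simps)
    finally show ?thesis .
  qed
  then show ?thesis by blast
qed

section \<open>Boundary integrals and the Cauchy-Pompeiu formula\<close>

lemma nbhd_sym: "x \<in> nbhd h y \<longleftrightarrow> y \<in> nbhd h x"
  unfolding nbhd_def by (auto simp: algebra_simps)

lemma nbhd_subset_Zh: "x \<in> Zh h \<Longrightarrow> nbhd h x \<subseteq> Zh h"
  by (auto simp: nbhd_def Zh_shift)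

lemma finite_nbhd: "finite (nbhd h x)"
proof -
  have "nbhd h x = {x} \<union> (\<lambda>l. x + h *\<^sub>R ebas l) ` {..<8} \<union> (\<lambda>l. x - h *\<^sub>R ebas l) ` {..<8}"
    by (auto simp: nbhd_def)
  then show ?thesis by simp
qed

lemma bdry_subset_UN_nbhd: "bdry h B \<subseteq> (\<Union>b\<in>B. nbhd h b)"
  by (auto simp: bdry_def) (use nbhd_sym in blast)

text \<open>\<open>bdry\<close> ranges over all points of the space; meeting a subset of the lattice
  within one step forces a point onto the lattice.\<close>

lemma bdry_subset_Zh: "B \<subseteq> Zh h \<Longrightarrow> bdry h B \<subseteq> Zh h"
  using bdry_subset_UN_nbhd nbhd_subset_Zh by blast

lemma bdry_eq_compl: "B \<subseteq> Zh h \<Longrightarrow> bdry h (Zh h - B) = bdry h B"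
  by (auto simp: bdry_def)

text \<open>This makes all indicator differences vanish off the boundary, so that boundary sums can
  be extended to a larger finite set.\<close>

lemma indicator_shift_outside_bdry:
  assumes "B \<subseteq> Zh h" "x \<in> Zh h" "x \<notin> bdry h B" "y \<in> nbhd h x"
  shows "indicator B y = (indicator B x :: real)"
proof -
  have "y \<in> Zh h" using assms nbhd_subset_Zh by blast
  moreover have "x \<in> nbhd h x" by (simp add: nbhd_def)
  ultimately show ?thesis
    using assms by (auto simp: bdry_def indicator_def)
qed

lemma sw_nplus:
  assumes "l < 8"
  shows "sw h B x * nplus h B l x = - (h ^ 8 * dplus h l (indicator B) x)"
    and "sw h B x * nminus h B l x = - (h ^ 8 * dminus h l (indicator B) x)"
proof -
  \<comment> \<open>If \<open>Sig h B x = 0\<close>, division by zero makes the normals vanish, and so do the differences.\<close>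
  have nn: "0 \<le> (dplus h l (indicator B) x :: real)\<^sup>2 + (dminus h l (indicator B) x)\<^sup>2" for l
    by simp
  have le: "(dplus h l (indicator B) x)\<^sup>2 + (dminus h l (indicator B) x)\<^sup>2 \<le> Sig h B x"
    unfolding Sig_def using assms nn by (intro member_le_sum) auto
  have "dplus h l (indicator B) x = (0::real) \<and> dminus h l (indicator B) x = (0::real)" if "Sig h B x = 0"
    using le that by (simp add: sum_power2_le_zero_iff)
  then show "sw h B x * nplus h B l x = - (h ^ 8 * dplus h l (indicator B) x)"
    and "sw h B x * nminus h B l x = - (h ^ 8 * dminus h l (indicator B) x)"
    by (cases "Sig h B x = 0"; simp add: sw_def nplus_def nminus_def)+
qed

text \<open>The square roots in weight and normals cancel, leaving plain indicator differences.
  Collecting them by \<open>x\<close>, \<open>x - h *\<^sub>R ebas l\<close> and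
  \<open>x + h *\<^sub>R ebas l\<close> prepares the summation by parts.\<close>

lemma sw_Kstar:
  assumes "h \<noteq> 0"
  shows "sw h B x *\<^sub>R Kstar h B x y a = (h ^ 7 / 2) *\<^sub>R (\<Sum>l<8.
      (indicator B x :: real) *\<^sub>R omul (Eh h (y - x + h *\<^sub>R ebas l) - Eh h (y - x - h *\<^sub>R ebas l)) (omul (ebas l) a)
      - (indicator B (x - h *\<^sub>R ebas l) :: real) *\<^sub>R omul (Eh h (y - x + h *\<^sub>R ebas l)) (omul (ebas l) a)
      + (indicator B (x + h *\<^sub>R ebas l) :: real) *\<^sub>R omul (Eh h (y - x - h *\<^sub>R ebas l)) (omul (ebas l) a))"
proof -
  have "sw h B x *\<^sub>R Kstar h B x y a = (\<Sum>l<8. (- (1/2)) *\<^sub>R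
     omul ((sw h B x * nminus h B l x) *\<^sub>R Eh h (h *\<^sub>R ebas l - x + y)
            + (sw h B x * nplus h B l x) *\<^sub>R Eh h (- (h *\<^sub>R ebas l) - x + y)) (omul (ebas l) a))"
    by (simp add: Kstar_def scaleR_right.sum omul.add_left omul.scaleR_left scaleR_add_right scaleR_diff_right scaleR_minus_right mult_ac)
  also have "\<dots> = (\<Sum>l<8. (h ^ 7 / 2) *\<^sub>R (
      (indicator B x :: real) *\<^sub>R omul (Eh h (y - x + h *\<^sub>R ebas l) - Eh h (y - x - h *\<^sub>R ebas l)) (omul (ebas l) a)
      - (indicator B (x - h *\<^sub>R ebas l) :: real) *\<^sub>R omul (Eh h (y - x + h *\<^sub>R ebas l)) (omul (ebas l) a)
      + (indicator B (x + h *\<^sub>R ebas l) :: real) *\<^sub>R omul (Eh h (y - x - h *\<^sub>R ebas l)) (omul (ebas l) a)))"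
  proof (rule sum.cong[OF refl])
    fix l :: nat assume "l \<in> {..<8}"
    then have l: "l < 8" by simp
    have e: "h *\<^sub>R ebas l - x + y = y - x + h *\<^sub>R ebas l" "- (h *\<^sub>R ebas l) - x + y = y - x - h *\<^sub>R ebas l"
      by simp_all
    have d: "h ^ 8 * dplus h l (indicator B) x = h ^ 7 * (indicator B (x + h *\<^sub>R ebas l) - indicator B x)"
      "h ^ 8 * dminus h l (indicator B) x = h ^ 7 * (indicator B x - indicator B (x - h *\<^sub>R ebas l))"
      using assms by (simp_all add: dplus_def dminus_def eval_nat_numeral)
    show "(- (1/2)) *\<^sub>R
     omul ((sw h B x * nminus h B l x) *\<^sub>R Eh h (h *\<^sub>R ebas l - x + y)
            + (sw h B x * nplus h B l x) *\<^sub>R Eh h (- (h *\<^sub>R ebas l) - x + y)) (omul (ebas l) a)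
       = (h ^ 7 / 2) *\<^sub>R (
      (indicator B x :: real) *\<^sub>R omul (Eh h (y - x + h *\<^sub>R ebas l) - Eh h (y - x - h *\<^sub>R ebas l)) (omul (ebas l) a)
      - (indicator B (x - h *\<^sub>R ebas l) :: real) *\<^sub>R omul (Eh h (y - x + h *\<^sub>R ebas l)) (omul (ebas l) a)
      + (indicator B (x + h *\<^sub>R ebas l) :: real) *\<^sub>R omul (Eh h (y - x - h *\<^sub>R ebas l)) (omul (ebas l) a))"
      unfolding sw_nplus[OF l] e d
      by (simp add: omul.add_left omul.diff_left omul.minus_left omul.scaleR_left
           scaleR_add_right scaleR_diff_right scaleR_add_left scaleR_diff_left right_diff_distrib left_diff_distrib diff_divide_distrib)
  qed
  finally show ?thesis by (simp add: scaleR_right.sum)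
qed

lemma sum_indicator_shift:
  fixes \<phi> :: "'a::ab_group_add \<Rightarrow> 'b::real_vector"
  assumes "finite F" "(\<lambda>z. z + s) ` B \<subseteq> F"
  shows "(\<Sum>x\<in>F. (indicator B (x - s) :: real) *\<^sub>R \<phi> x) = (\<Sum>z\<in>B. \<phi> (z + s))"
proof -
  have "(\<Sum>z\<in>B. \<phi> (z + s)) = (\<Sum>x\<in>(\<lambda>z. z + s) ` B. \<phi> x)"
    by (subst sum.reindex) (auto simp: inj_on_def)
  also have "\<dots> = (\<Sum>x\<in>(\<lambda>z. z + s) ` B. (indicator B (x - s) :: real) *\<^sub>R \<phi> x)"
    by (rule sum.cong[OF refl]) auto
  also have "\<dots> = (\<Sum>x\<in>F. (indicator B (x - s) :: real) *\<^sub>R \<phi> x)"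
  proof (rule sum.mono_neutral_left[OF assms], safe)
    fix x assume "x \<notin> (\<lambda>z. z + s) ` B"
    then have "x - s \<notin> B" by (metis diff_add_cancel image_eqI)
    then show "(indicator B (x - s) :: real) *\<^sub>R \<phi> x = 0" by simp
  qed
  finally show ?thesis by simp
qed

text \<open>The discrete Cauchy-Pompeiu formula. Summation by parts moves the shifts of the
  indicator onto \<open>g\<close>: the unshifted terms give the delta function and the shifted ones
  give D^h g.\<close>

lemma bint_Kstar:
  assumes "h > 0" "finite B" "B \<subseteq> Zh h" "y \<in> Zh h"
  shows "bint h B (\<lambda>x. Kstar h B x y (g x)) = (if y \<in> B then g y else 0) - volpot h B g y"
proof -
  have h: "h \<noteq> 0" using assms(1) by simp
  \<comment> \<open>A finite set containing the boundary, \<open>B\<close> and all one-step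
    translates of \<open>B\<close>, so each shifted sum can be reindexed over
    \<open>B\<close>.\<close>
  define F where "F = (\<Union>b\<in>B. nbhd h b)"
  have F: "finite F" "F \<subseteq> Zh h" "bdry h B \<subseteq> F"
    using assms nbhd_subset_Zh bdry_subset_UN_nbhd by (auto simp: F_def finite_nbhd)
  have shifts: "(\<lambda>z. z + 0) ` B \<subseteq> F" "l < 8 \<Longrightarrow> (\<lambda>z. z + h *\<^sub>R ebas l) ` B \<subseteq> F"
     "l < 8 \<Longrightarrow> (\<lambda>z. z + - (h *\<^sub>R ebas l)) ` B \<subseteq> F" for l
    by (auto simp: F_def nbhd_def)
  define a where "a l x = omul (ebas l) (g x)" for l x
  define T where "T l x = (indicator B (x - 0) :: real) *\<^sub>R omul (Eh h (y - x + h *\<^sub>R ebas l) - Eh h (y - x - h *\<^sub>R ebas l)) (a l x)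
      - (indicator B (x - h *\<^sub>R ebas l) :: real) *\<^sub>R omul (Eh h (y - x + h *\<^sub>R ebas l)) (a l x)
      + (indicator B (x - (- (h *\<^sub>R ebas l))) :: real) *\<^sub>R omul (Eh h (y - x - h *\<^sub>R ebas l)) (a l x)" for l x
  have K: "sw h B x *\<^sub>R Kstar h B x y (g x) = (h ^ 7 / 2) *\<^sub>R (\<Sum>l<8. T l x)" for x
    unfolding sw_Kstar[OF h] T_def a_def by simp
  have T0: "T l x = 0" if "x \<in> F - bdry h B" "l < 8" for l x
  proof -
    have "x \<in> Zh h" "x \<notin> bdry h B" using that F by auto
    moreover have "x - h *\<^sub>R ebas l \<in> nbhd h x" "x + h *\<^sub>R ebas l \<in> nbhd h x"
      using that(2) by (auto simp: nbhd_def)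
    ultimately have "indicator B (x - h *\<^sub>R ebas l) = (indicator B x :: real)"
       "indicator B (x + h *\<^sub>R ebas l) = (indicator B x :: real)"
      using indicator_shift_outside_bdry[OF assms(3)] by blast+
    then show ?thesis
      by (simp add: T_def omul.diff_left scaleR_diff_right)
  qed
  have "bint h B (\<lambda>x. Kstar h B x y (g x)) = (\<Sum>x\<in>bdry h B. (h ^ 7 / 2) *\<^sub>R (\<Sum>l<8. T l x))"
    by (simp add: bint_def K)
  also have "\<dots> = (\<Sum>x\<in>F. (h ^ 7 / 2) *\<^sub>R (\<Sum>l<8. T l x))"
    using F T0 by (intro sum.mono_neutral_left) auto
  also have "\<dots> = (h ^ 7 / 2) *\<^sub>R (\<Sum>l<8. \<Sum>x\<in>F. T l x)"
    by (subst sum.swap) (simp add: scaleR_right.sum)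
  \<comment> \<open>Substituting \<open>x = z + h *\<^sub>R ebas l\<close> or
    \<open>x = z - h *\<^sub>R ebas l\<close> cancels the shift in the kernel, so both shifted terms
    carry the same factor \<open>Eh h (y - z)\<close>.\<close>
  also have "(\<Sum>l<8. \<Sum>x\<in>F. T l x) = (\<Sum>l<8.
      (\<Sum>z\<in>B. omul (Eh h (y - z + h *\<^sub>R ebas l) - Eh h (y - z - h *\<^sub>R ebas l)) (a l z))
      - (\<Sum>z\<in>B. omul (Eh h (y - z)) (a l (z + h *\<^sub>R ebas l) - a l (z - h *\<^sub>R ebas l))))"
  proof (rule sum.cong[OF refl])
    fix l :: nat assume "l \<in> {..<8}"
    then have l: "l < 8" by simp
    show "(\<Sum>x\<in>F. T l x) = (\<Sum>z\<in>B. omul (Eh h (y - z + h *\<^sub>R ebas l) - Eh h (y - z - h *\<^sub>R ebas l)) (a l z))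
      - (\<Sum>z\<in>B. omul (Eh h (y - z)) (a l (z + h *\<^sub>R ebas l) - a l (z - h *\<^sub>R ebas l)))"
      unfolding T_def sum.distrib sum_subtractf sum_indicator_shift[OF F(1) shifts(1)]
        sum_indicator_shift[OF F(1) shifts(2)[OF l]] sum_indicator_shift[OF F(1) shifts(3)[OF l]]
      by (simp add: omul.diff_right sum_subtractf algebra_simps)
  qed
  also have "\<dots> = (\<Sum>z\<in>B. \<Sum>l<8. omul (Eh h (y - z + h *\<^sub>R ebas l) - Eh h (y - z - h *\<^sub>R ebas l)) (a l z))
      - (\<Sum>z\<in>B. \<Sum>l<8. omul (Eh h (y - z)) (a l (z + h *\<^sub>R ebas l) - a l (z - h *\<^sub>R ebas l)))"
    unfolding sum_subtractf by (subst (1 2) sum.swap) simp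
  also have "(\<Sum>z\<in>B. \<Sum>l<8. omul (Eh h (y - z + h *\<^sub>R ebas l) - Eh h (y - z - h *\<^sub>R ebas l)) (a l z))
      = (\<Sum>z\<in>B. if z = y then (2 / h ^ 7) *\<^sub>R g y else 0)"
  proof (rule sum.cong[OF refl])
    fix z assume "z \<in> B"
    then have "y - z \<in> Zh h" using assms by (auto intro: Zh_diff)
    from Eh_difference_omul_right[OF h this, of "g z"]
    show "(\<Sum>l<8. omul (Eh h (y - z + h *\<^sub>R ebas l) - Eh h (y - z - h *\<^sub>R ebas l)) (a l z))
       = (if z = y then (2 / h ^ 7) *\<^sub>R g y else 0)"
      by (auto simp: a_def)
  qed
  also have "\<dots> = (2 / h ^ 7) *\<^sub>R (if y \<in> B then g y else 0)"
    using assms(2) by simp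
  also have "(\<Sum>z\<in>B. \<Sum>l<8. omul (Eh h (y - z)) (a l (z + h *\<^sub>R ebas l) - a l (z - h *\<^sub>R ebas l)))
      = (2 * h) *\<^sub>R (\<Sum>z\<in>B. omul (Eh h (y - z)) (Dh h g z))"
    using h by (simp add: Dh_eq a_def omul.diff_right omul.sum_right omul.scaleR_right scaleR_right.sum)
  finally show ?thesis
    using h by (simp add: volpot_def scaleR_diff_right eval_nat_numeral)
qed

section \<open>The boundary operators expressed through the potential\<close>

lemma Dh_diff: "Dh h (\<lambda>x. f x - g x) y = Dh h f y - Dh h g y"
  by (simp add: Dh_def dcent_def dplus_def dminus_def omul.scaleR_right omul.diff_right omul.add_right
      scaleR_diff_right scaleR_add_right sum_subtractf sum.distrib algebra_simps)

lemma Dh_const: "Dh h (\<lambda>x. c) y = 0"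
  by (simp add: Dh_def dcent_def dplus_def dminus_def omul.zero_right)

text \<open>Subtracting the constant \<open>g y\<close> kills the indicator term of the
  Cauchy-Pompeiu formula and leaves D^h g unchanged, so the result does not depend on whether
  \<open>y\<close> lies in \<open>B\<close>.\<close>

lemma Sop_eq:
  assumes "h > 0" "finite B" "B \<subseteq> Zh h" "y \<in> Zh h"
  shows "Sop h B g y = g y - 2 *\<^sub>R volpot h B g y"
  using bint_Kstar[OF assms, of "\<lambda>x. g x - g y"]
  by (simp add: Sop_def volpot_def Dh_diff Dh_const)

lemma Pop_eq:
  assumes "h > 0" "finite B" "B \<subseteq> Zh h" "y \<in> Zh h"
  shows "Pop h B g y = g y - volpot h B g y"
  by (simp add: Pop_def Sop_eq[OF assms] scaleR_diff_right scaleR_add_right flip: scaleR_2)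

lemma Qop_eq:
  assumes "h > 0" "finite B" "B \<subseteq> Zh h" "y \<in> Zh h"
  shows "Qop h B g y = volpot h B g y"
  by (simp add: Qop_def Sop_eq[OF assms])

lemma Sop_cong_bdry:
  assumes "\<And>x. x \<in> bdry h B \<Longrightarrow> f x = g x" "y \<in> bdry h B"
  shows "Sop h B f y = Sop h B g y"
  using assms by (simp add: Sop_def bint_def)

section \<open>A Liouville theorem\<close>

lemma add_step_twice:
  fixes x :: pt
  shows "x + h *\<^sub>R e + h *\<^sub>R e = x + (2 * h) *\<^sub>R e" "x - h *\<^sub>R e - h *\<^sub>R e = x - (2 * h) *\<^sub>R e"
  unfolding scaleR_scaleR[symmetric] scaleR_2 by simp_all

lemma dcent_commute: "dcent h k (dcent h l w) x = dcent h l (dcent h k w) x"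
  by (simp add: dcent_def dplus_def dminus_def algebra_simps)

lemma dcent_Dh: "dcent h k (Dh h w) x = (\<Sum>l<8. omul (ebas l) (dcent h k (dcent h l w) x))"
  by (simp add: Dh_def dcent_def[of h k] dplus_def[of h k] dminus_def[of h k] omul.scaleR_right omul.diff_right omul.add_right
      scaleR_right.sum sum_subtractf sum.distrib scaleR_diff_right scaleR_add_right)

text \<open>Applying the conjugate difference operator to D^h w gives the sum of second central
  differences, by the polar identity and the commutation of differences.\<close>

lemma laplacian_of_monogenic:
  assumes h: "h \<noteq> 0" and D: "\<And>y. y \<in> Zh h \<Longrightarrow> Dh h w y = 0" and x: "x \<in> Zh h"
  shows "(\<Sum>l<8. dcent h l (dcent h l w) x) = 0"
proof -
  have "(\<Sum>l<8. dcent h l (dcent h l w) x)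
     = (\<Sum>k<8. \<Sum>l<8. csgn k *\<^sub>R omul (ebas k) (omul (ebas l) (dcent h k (dcent h l w) x)))"
  proof (rule sum_symmetric_pairs[symmetric])
    fix k l :: nat assume "k \<in> {..<8}" "l \<in> {..<8}"
    then show "csgn k *\<^sub>R omul (ebas k) (omul (ebas l) (dcent h k (dcent h l w) x))
      + csgn l *\<^sub>R omul (ebas l) (omul (ebas k) (dcent h l (dcent h k w) x))
      = (if k = l then 2 *\<^sub>R dcent h k (dcent h k w) x else 0)"
      unfolding dcent_commute[of h l k] by (subst omul_conj_polar) auto
  qed simp
  also have "\<dots> = (\<Sum>k<8. csgn k *\<^sub>R omul (ebas k) (dcent h k (Dh h w) x))"
    by (simp add: dcent_Dh omul.sum_right scaleR_right.sum)
  also have "\<dots> = 0"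
    using h D x by (simp add: dcent_eq Zh_shift omul.zero_right)
  finally show ?thesis .
qed

text \<open>A central difference applied twice has step \<open>2 * h\<close>, so the mean is over 16
  points at that distance.\<close>

lemma mean_value_of_monogenic:
  assumes h: "h \<noteq> 0" and D: "\<And>y. y \<in> Zh h \<Longrightarrow> Dh h w y = 0" and x: "x \<in> Zh h"
  shows "16 *\<^sub>R w x = (\<Sum>l<8. w (x + (2 * h) *\<^sub>R ebas l) + w (x - (2 * h) *\<^sub>R ebas l))"
proof -
  have "dcent h l (dcent h l w) x = (1 / (2 * h))\<^sup>2 *\<^sub>R
      ((w (x + (2 * h) *\<^sub>R ebas l) + w (x - (2 * h) *\<^sub>R ebas l)) - 2 *\<^sub>R w x)" for l
    using h by (simp add: dcent_eq power2_eq_square add_step_twice scaleR_diff_right scaleR_add_right scaleR_2)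
  then have "(1 / (2 * h))\<^sup>2 *\<^sub>R ((\<Sum>l<8. w (x + (2 * h) *\<^sub>R ebas l) + w (x - (2 * h) *\<^sub>R ebas l)) - 16 *\<^sub>R w x) = 0"
    using laplacian_of_monogenic[OF assms]
    by (simp add: sum_subtractf flip: scaleR_right.sum)
  then show ?thesis using h by simp
qed

text \<open>Maximum principle: decay forces a nonzero function to attain its maximal norm, and the
  mean value property then propagates that norm along an infinite ray.\<close>

lemma monogenic_decaying_eq_0:
  assumes h: "h > 0" and D: "\<And>y. y \<in> Zh h \<Longrightarrow> Dh h w y = 0"
    and decay: "\<And>\<epsilon>. \<epsilon> > 0 \<Longrightarrow> \<exists>R. \<forall>y\<in>Zh h. norm y > R \<longrightarrow> norm (w y) < \<epsilon>"
    and x0: "x0 \<in> Zh h"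
  shows "w x0 = 0"
proof (rule ccontr)
  assume "w x0 \<noteq> 0"
  \<comment> \<open>Decay makes this set bounded, hence finite on the lattice, so a maximum over it
    exists and is the maximum over the whole lattice.\<close>
  define A where "A = {x \<in> Zh h. norm (w x0) \<le> norm (w x)}"
  obtain R where R: "\<forall>y\<in>Zh h. norm y > R \<longrightarrow> norm (w y) < norm (w x0)"
    using decay[of "norm (w x0)"] \<open>w x0 \<noteq> 0\<close> by auto
  then have "bounded A"
    unfolding bounded_iff A_def by (intro exI[of _ R]) (auto simp: not_less[symmetric])
  then have fin: "finite A" using h by (intro finite_bounded_Zh) (auto simp: A_def)
  have ne: "A \<noteq> {}" using x0 by (auto simp: A_def)
  define m where "m = Max ((\<lambda>x. norm (w x)) ` A)"
  have m_le: "norm (w x) \<le> m" if "x \<in> Zh h" for x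
  proof (cases "x \<in> A")
    case True then show ?thesis unfolding m_def using fin by (intro Max_ge) auto
  next
    case False
    then have "norm (w x) \<le> norm (w x0)" using that by (auto simp: A_def)
    also have "\<dots> \<le> m" unfolding m_def using fin x0 by (intro Max_ge) (auto simp: A_def)
    finally show ?thesis .
  qed
  obtain x1 where x1: "x1 \<in> A" "norm (w x1) = m"
    using Max_in[of "(\<lambda>x. norm (w x)) ` A"] fin ne unfolding m_def by fastforce
  have step: "norm (w (x + (2 * h) *\<^sub>R ebas 0)) = m" if x: "x \<in> Zh h" "norm (w x) = m" for x
  proof -
    have Z: "x + (2 * h) *\<^sub>R ebas l \<in> Zh h" "x - (2 * h) *\<^sub>R ebas l \<in> Zh h" for l
      using Zh_shift(1)[OF Zh_shift(1)[OF x(1)], of l l] Zh_shift(2)[OF Zh_shift(2)[OF x(1)], of l l]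
      by (simp_all add: add_step_twice)
    define p where "p l = norm (w (x + (2 * h) *\<^sub>R ebas l)) + norm (w (x - (2 * h) *\<^sub>R ebas l))" for l
    have p_le: "p l \<le> 2 * m" for l
      unfolding p_def using m_le[OF Z(1)[of l]] m_le[OF Z(2)[of l]] by simp
    have "16 * m = norm (16 *\<^sub>R w x)" using x by simp
    also have "\<dots> = norm (\<Sum>l<8. w (x + (2 * h) *\<^sub>R ebas l) + w (x - (2 * h) *\<^sub>R ebas l))"
      using mean_value_of_monogenic[of h w x] h D x(1) by simp
    also have "\<dots> \<le> (\<Sum>l<8. p l)"
      unfolding p_def by (intro sum_norm_le norm_triangle_ineq)
    also have "\<dots> = p 0 + (\<Sum>l\<in>{..<8} - {0}. p l)"
      by (rule sum.remove) auto
    also have "(\<Sum>l\<in>{..<8} - {0}. p l) \<le> (\<Sum>l\<in>{..<8} - {0::nat}. 2 * m)"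
      by (intro sum_mono p_le)
    \<comment> \<open>Fourteen of the sixteen norms contribute at most \<open>14 * m\<close>, so the
      two in direction 0 must both equal \<open>m\<close>.\<close>
    finally have "16 * m \<le> p 0 + 14 * m" by simp
    then show ?thesis
      using m_le[OF Z(1)[of 0]] m_le[OF Z(2)[of 0]] unfolding p_def by linarith
  qed
  define X where "X n = x1 + (2 * h * real n) *\<^sub>R ebas 0" for n
  have X: "X n \<in> Zh h \<and> norm (w (X n)) = m" for n
  proof (induction n)
    case 0
    then show ?case using x1 by (simp add: X_def A_def)
  next
    case (Suc n)
    have "X (Suc n) = X n + (2 * h) *\<^sub>R ebas 0"
      by (simp add: X_def distrib_left scaleR_add_left)
    moreover have "X n + (2 * h) *\<^sub>R ebas 0 \<in> Zh h"
      using Zh_shift(1)[OF Zh_shift(1)[of "X n" h 0], of 0] Suc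
      by (simp add: add_step_twice)
    ultimately show ?case using step Suc by auto
  qed
  have "X n \<in> A" for n
    using X[of n] m_le[OF x0] by (simp add: A_def)
  then have "range X \<subseteq> A" by auto
  then have "finite (range X)" using fin finite_subset by blast
  moreover have "inj X"
    using h by (auto simp: inj_on_def X_def ebas_def axis_eq_0_iff)
  ultimately show False by (simp add: finite_image_iff)
qed

section \<open>The criteria for interior and exterior extension\<close>

theorem mainTheorem13:
  fixes h :: real and B :: "pt set" and f :: "pt \<Rightarrow> oct"
  assumes "h > 0" and "B \<subseteq> Zh h" and "bounded B"
  shows "((\<exists>u :: pt \<Rightarrow> oct. (\<forall>y\<in>B. Dh h u y = 0) \<and> (\<forall>y\<in>bdry h B. u y = f y))
            \<longleftrightarrow> (\<forall>y\<in>bdry h B. Pop h B f y = f y))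
       \<and> ((\<exists>v :: pt \<Rightarrow> oct. (\<forall>y\<in>Zh h - B. Dh h v y = 0)
              \<and> (\<forall>\<epsilon>>0. \<exists>R. \<forall>y\<in>clos h (Zh h - B). norm y > R \<longrightarrow> norm (v y) < \<epsilon>)
              \<and> (\<forall>y\<in>bdry h B. v y = f y))
            \<longleftrightarrow> (\<forall>y\<in>bdry h B. Qop h B f y = f y))"
proof -
  have fin: "finite B" using assms by (intro finite_bounded_Zh)
  have bZ: "y \<in> Zh h" if "y \<in> bdry h B" for y using that bdry_subset_Zh[OF assms(2)] by blast
  note P = Pop_eq[OF assms(1) fin assms(2)] and Q = Qop_eq[OF assms(1) fin assms(2)]
    and DV = Dh_volpot[OF assms(1) fin assms(2)]
  \<comment> \<open>The potential is defined through values in the interior of \<open>B\<close> as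
    well, but on the boundary it is a combination of \<open>g\<close> and \<open>Sop\<close>, which
    see boundary values only.\<close>
  have volpot_cong: "volpot h B g y = volpot h B f y" if "\<And>x. x \<in> bdry h B \<Longrightarrow> g x = f x" "y \<in> bdry h B" for g y
    using Sop_cong_bdry[of h B g f y] that
    by (simp add: Q[OF bZ, symmetric] Qop_def)
  have 1: "(\<exists>u :: pt \<Rightarrow> oct. (\<forall>y\<in>B. Dh h u y = 0) \<and> (\<forall>y\<in>bdry h B. u y = f y))
            \<longleftrightarrow> (\<forall>y\<in>bdry h B. Pop h B f y = f y)" (is "?L \<longleftrightarrow> ?R")
  proof
    assume ?L
    then obtain u where u: "\<forall>y\<in>B. Dh h u y = 0" "\<forall>y\<in>bdry h B. u y = f y" by blast
    have "volpot h B u y = 0" for y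
      using u(1) by (simp add: volpot_def omul.zero_right)
    then show ?R
      using volpot_cong[of u] u(2) by (auto simp: P bZ)
  next
    assume ?R
    \<comment> \<open>Since \<open>f\<close> is total, its values off the boundary are arbitrary;
      the potential removes exactly the D^h f they create in \<open>B\<close>.\<close>
    define u where "u = (\<lambda>y. f y - volpot h B f y)"
    have "Dh h u y = 0" if "y \<in> B" for y
      using that assms(2) by (auto simp: u_def Dh_diff DV)
    moreover have "u y = f y" if "y \<in> bdry h B" for y
      using \<open>?R\<close> that P[OF bZ[OF that], of f] by (simp add: u_def)
    ultimately show ?L by blast
  qed
  have 2: "(\<exists>v :: pt \<Rightarrow> oct. (\<forall>y\<in>Zh h - B. Dh h v y = 0)
              \<and> (\<forall>\<epsilon>>0. \<exists>R. \<forall>y\<in>clos h (Zh h - B). norm y > R \<longrightarrow> norm (v y) < \<epsilon>)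
              \<and> (\<forall>y\<in>bdry h B. v y = f y))
            \<longleftrightarrow> (\<forall>y\<in>bdry h B. Qop h B f y = f y)" (is "?L \<longleftrightarrow> ?R")
  proof
    assume ?L
    then obtain v where v: "\<forall>y\<in>Zh h - B. Dh h v y = 0" "\<forall>y\<in>bdry h B. v y = f y"
        "\<forall>\<epsilon>>0. \<exists>R. \<forall>y\<in>clos h (Zh h - B). norm y > R \<longrightarrow> norm (v y) < \<epsilon>" by blast
    \<comment> \<open>Subtracting the potential cancels D^h v inside \<open>B\<close>, so
      \<open>w\<close> satisfies the equation on the whole lattice and the Liouville theorem
      applies.\<close>
    define w where "w = (\<lambda>y. v y - volpot h B v y)"
    have "w y = 0" if "y \<in> Zh h" for y
    proof (rule monogenic_decaying_eq_0[OF assms(1) _ _ that])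
      show "Dh h w y = 0" if "y \<in> Zh h" for y
        using that v(1) by (simp add: w_def Dh_diff DV)
      fix \<epsilon> :: real assume \<epsilon>: "\<epsilon> > 0"
      obtain R1 where R1: "\<forall>y\<in>clos h (Zh h - B). norm y > R1 \<longrightarrow> norm (v y) < \<epsilon> / 2"
        using v(3) \<epsilon> half_gt_zero by blast
      obtain R2 where R2: "\<forall>y\<in>Zh h. norm y > R2 \<longrightarrow> norm (volpot h B v y) < \<epsilon> / 2"
        using volpot_tendsto_zero[OF assms(1) fin assms(2), of "\<epsilon> / 2"] \<epsilon> by auto
      \<comment> \<open>Beyond this radius a lattice point lies outside \<open>B\<close>, where the
        decay hypothesis on \<open>v\<close> is available.\<close>
      obtain R3 where R3: "\<And>y. y \<in> B \<Longrightarrow> norm y \<le> R3"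
        using assms(3) by (auto simp: bounded_iff)
      have "norm (w y) < \<epsilon>" if y: "y \<in> Zh h" "norm y > max R1 (max R2 R3)" for y
      proof -
        have "y \<in> clos h (Zh h - B)" using y R3[of y] by (auto simp: clos_def)
        then have "norm (v y) < \<epsilon> / 2" "norm (volpot h B v y) < \<epsilon> / 2"
          using R1 R2 y by auto
        then show ?thesis
          unfolding w_def using norm_triangle_ineq4[of "v y" "volpot h B v y"] by linarith
      qed
      then show "\<exists>R. \<forall>y\<in>Zh h. norm y > R \<longrightarrow> norm (w y) < \<epsilon>" by blast
    qed
    then have "volpot h B v y = v y" if "y \<in> Zh h" for y
      using that by (simp add: w_def)
    then show ?R
      using volpot_cong[of v] v(2) bZ by (auto simp: Q)
  next
    assume ?R
    \<comment> \<open>The potential of \<open>f\<close> is itself the exterior extension.\<close>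
    have "\<forall>y\<in>Zh h - B. Dh h (volpot h B f) y = 0"
      by (simp add: DV)
    moreover have "\<forall>\<epsilon>>0. \<exists>R. \<forall>y\<in>clos h (Zh h - B). norm y > R \<longrightarrow> norm (volpot h B f y) < \<epsilon>"
    proof (intro allI impI)
      fix \<epsilon> :: real assume "\<epsilon> > 0"
      moreover have "clos h (Zh h - B) \<subseteq> Zh h"
        using bZ by (auto simp: clos_def bdry_eq_compl[OF assms(2)])
      ultimately show "\<exists>R. \<forall>y\<in>clos h (Zh h - B). norm y > R \<longrightarrow> norm (volpot h B f y) < \<epsilon>"
        using volpot_tendsto_zero[OF assms(1) fin assms(2), of \<epsilon>] by blast
    qed
    moreover have "\<forall>y\<in>bdry h B. volpot h B f y = f y"
      using \<open>?R\<close> by (auto simp: Q bZ)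
    ultimately show ?L by blast
  qed
  from 1 2 show ?thesis by (rule conjI)
qed

end
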